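(* The periodic broken ray transform is injective for the Riemannian manifold with boundary $M=\{(x_1,x_2,x_3)\in S^2: x_i\ge0\ \forall i\}$ when restricted to smooth functions with vanishing normal derivatives of odd order at the boundary.
   Context: $S^2\subset\mathbb{R}^3$ is the unit sphere with the round metric. A periodic broken ray in a Riemannian manifold $M$ with boundary is a periodic piecewise geodesic path in $M$ that is a geodesic in the interior and is reflected at the boundary (the whole of $\partial M$ is reflecting) according to the usual reflection law (angle of incidence equals angle of reflection). Let $\Gamma$ be the set of all periodic broken rays. The periodic broken ray transform is the map taking a continuous $f:M\to\mathbb{R}$ to the function $\gamma\mapsto\int_{\operatorname{tr}(\gamma)}f\,d\mathcal{H}^1$ on $\Gamma$, where $\operatorname{tr}(\gamma)$ is the trace (image) of $\gamma$ and $\mathcal{H}^1$ is one-dimensional Hausdorff measure. *)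

theory Defs
  imports "HOL-Analysis.Analysis"
begin

section \<open>The spherical octant\<close>

abbreviation unit_sphere :: "(real^3) set" where
  "unit_sphere \<equiv> sphere 0 1"

definition octant :: "(real^3) set" where
  "octant = {x \<in> unit_sphere. \<forall>i. 0 \<le> x $ i}"

text \<open>The octant is a manifold with corners. On the open face \<open>x $ i = 0\<close> the vector \<open>axis i 1\<close>
  is tangent to the sphere and is the inward unit normal; at the three corners, where two
  coordinates vanish, there is no normal.\<close>

definition octant_interior :: "(real^3) set" where
  "octant_interior = {x \<in> unit_sphere. \<forall>i. 0 < x $ i}"

definition octant_face :: "3 \<Rightarrow> (real^3) set" where
  "octant_face i = {x \<in> unit_sphere. x $ i = 0 \<and> (\<forall>j. j \<noteq> i \<longrightarrow> 0 < x $ j)}"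


section \<open>One-dimensional Hausdorff measure on the round sphere\<close>

text \<open>The Riemannian distance of the round metric. Since the octant is geodesically convex, this
  is also its own Riemannian distance.\<close>

definition sphere_dist :: "real^3 \<Rightarrow> real^3 \<Rightarrow> real" where
  "sphere_dist p q = arccos (p \<bullet> q)"

definition sphere_diam :: "(real^3) set \<Rightarrow> ennreal" where
  "sphere_diam U = (SUP (p, q) \<in> U \<times> U. ennreal (sphere_dist p q))"

definition hausdorff1_pre :: "real \<Rightarrow> (real^3) set \<Rightarrow> ennreal" where
  "hausdorff1_pre \<delta> A =
     (INF U \<in> {U :: nat \<Rightarrow> (real^3) set. (\<forall>n. U n \<subseteq> unit_sphere \<and> sphere_diam (U n) \<le> ennreal \<delta>) \<and>
                A \<subseteq> (\<Union>n. U n)}. \<Sum>n. sphere_diam (U n))"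

definition hausdorff1_outer :: "(real^3) set \<Rightarrow> ennreal" where
  "hausdorff1_outer A = (SUP \<delta> \<in> {0<..}. hausdorff1_pre \<delta> A)"

definition hausdorff1 :: "(real^3) measure" where
  "hausdorff1 = measure_of unit_sphere (sets (restrict_space borel unit_sphere)) hausdorff1_outer"

text \<open>\<^const>\<open>measure_of\<close> yields the zero measure if the given set function is not countably
  additive, so we check that \<^const>\<open>hausdorff1\<close> really is the Hausdorff measure.\<close>

lemma hausdorff1_outer_empty: "hausdorff1_outer {} = 0"
proof -
  have "hausdorff1_pre \<delta> {} \<le> 0" for \<delta>
    unfolding hausdorff1_pre_def
    by (rule INF_lower2[of "\<lambda>_. {}"]) (auto simp: sphere_diam_def bot_ennreal)
  then show ?thesis by (simp add: hausdorff1_outer_def)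
qed

lemma hausdorff1_pre_mono:
  "A \<subseteq> B \<Longrightarrow> \<delta> \<le> \<epsilon> \<Longrightarrow> hausdorff1_pre \<epsilon> A \<le> hausdorff1_pre \<delta> B"
  unfolding hausdorff1_pre_def
  by (rule INF_superset_mono) (auto intro: order_trans ennreal_leI)

lemma hausdorff1_outer_mono: "A \<subseteq> B \<Longrightarrow> hausdorff1_outer A \<le> hausdorff1_outer B"
  unfolding hausdorff1_outer_def by (intro SUP_mono) (auto intro: hausdorff1_pre_mono)

lemma hausdorff1_pre_le_outer: "0 < \<delta> \<Longrightarrow> hausdorff1_pre \<delta> A \<le> hausdorff1_outer A"
  unfolding hausdorff1_outer_def by (rule SUP_upper) auto

lemma hausdorff1_pre_subadditive:
  "hausdorff1_pre \<delta> (\<Union>i. A i) \<le> (\<Sum>i. hausdorff1_pre \<delta> (A i))"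
proof (rule ennreal_le_epsilon)
  fix e :: real assume e: "0 < e" and fin: "(\<Sum>i. hausdorff1_pre \<delta> (A i)) < top"
  have "\<exists>U. (\<forall>n. U n \<subseteq> unit_sphere \<and> sphere_diam (U n) \<le> ennreal \<delta>) \<and> A i \<subseteq> (\<Union>n. U n) \<and>
          (\<Sum>n. sphere_diam (U n)) \<le> hausdorff1_pre \<delta> (A i) + ennreal (e * (1/2)^Suc i)" for i
  proof -
    have "hausdorff1_pre \<delta> (A i) < top"
      using ennreal_suminf_lessD[OF fin] .
    then have "hausdorff1_pre \<delta> (A i) < hausdorff1_pre \<delta> (A i) + ennreal (e * (1/2)^Suc i)"
      using e by (cases "hausdorff1_pre \<delta> (A i)") (auto simp flip: ennreal_plus simp: ennreal_less_iff)
    then show ?thesis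
      unfolding hausdorff1_pre_def[of _ "A i"] INF_less_iff by (auto intro: less_imp_le)
  qed
  then obtain U where U: "\<And>i n. U i n \<subseteq> unit_sphere" "\<And>i n. sphere_diam (U i n) \<le> ennreal \<delta>"
      "\<And>i. A i \<subseteq> (\<Union>n. U i n)"
      "\<And>i. (\<Sum>n. sphere_diam (U i n)) \<le> hausdorff1_pre \<delta> (A i) + ennreal (e * (1/2)^Suc i)"
    by metis
  define V where "V n = (case prod_decode n of (i, j) \<Rightarrow> U i j)" for n
  have V: "V n \<subseteq> unit_sphere \<and> sphere_diam (V n) \<le> ennreal \<delta>" for n
    using U(1,2) by (cases "prod_decode n") (simp add: V_def)
  have "hausdorff1_pre \<delta> (\<Union>i. A i) \<le> (\<Sum>n. sphere_diam (V n))"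
    unfolding hausdorff1_pre_def
  proof (rule INF_lower, safe)
    fix x i assume "x \<in> A i"
    then obtain j where "x \<in> U i j" using U(3) by blast
    then have "x \<in> V (prod_encode (i, j))" by (simp add: V_def)
    then show "x \<in> (\<Union>n. V n)" by blast
  qed (use V in blast)+
  also have "\<dots> = (\<Sum>n. case prod_decode n of (i, j) \<Rightarrow> sphere_diam (U i j))"
    by (intro suminf_cong) (auto simp: V_def split: prod.splits)
  also have "\<dots> = (\<Sum>i. \<Sum>j. sphere_diam (U i j))"
    using suminf_ennreal_2dimen[of "\<lambda>i. \<Sum>j. sphere_diam (U i j)" "\<lambda>(i, j). sphere_diam (U i j)"]
    by (simp add: o_def)
  also have "\<dots> \<le> (\<Sum>i. hausdorff1_pre \<delta> (A i) + ennreal (e * (1/2)^Suc i))"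
    by (intro suminf_le U) auto
  also have "\<dots> = (\<Sum>i. hausdorff1_pre \<delta> (A i)) + (\<Sum>i. ennreal (e * (1/2)^Suc i))"
    by (simp add: suminf_add)
  also have "(\<Sum>i. ennreal (e * (1/2)^Suc i)) = ennreal e"
    using e sums_mult[OF power_half_series, of e] by (intro suminf_ennreal_eq) auto
  finally show "hausdorff1_pre \<delta> (\<Union>i. A i) \<le> (\<Sum>i. hausdorff1_pre \<delta> (A i)) + ennreal e" .
qed

lemma hausdorff1_outer_subadditive:
  "hausdorff1_outer (\<Union>i. A i) \<le> (\<Sum>i. hausdorff1_outer (A i))"
  unfolding hausdorff1_outer_def[of "\<Union>i. A i"]
  by (intro SUP_least order_trans[OF hausdorff1_pre_subadditive] suminf_le hausdorff1_pre_le_outer) auto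

lemma dist_le_sphere_dist:
  assumes "p \<in> unit_sphere" "q \<in> unit_sphere"
  shows "dist p q \<le> sphere_dist p q"
proof -
  have le: "\<bar>p \<bullet> q\<bar> \<le> 1"
    using Cauchy_Schwarz_ineq2[of p q] assms by simp
  define t where "t = arccos (p \<bullet> q)"
  have t: "0 \<le> t" "cos t = p \<bullet> q"
    using le by (auto simp: t_def arccos_lbound cos_arccos_abs)
  have "(dist p q)\<^sup>2 = 2 - 2 * cos t"
    using assms t by (simp add: dist_norm power2_norm_eq_inner inner_diff inner_commute norm_eq_1)
  also have "\<dots> = (2 * sin (t/2))\<^sup>2"
    using cos_double_sin[of "t/2"] by (simp add: power_mult_distrib)
  also have "\<dots> \<le> t\<^sup>2"
    using abs_sin_x_le_abs_x[of "t/2"] t unfolding abs_le_square_iff[symmetric] by (simp add: abs_mult)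
  finally show ?thesis
    using t by (simp add: sphere_dist_def power2_le_iff_abs_le flip: t_def)
qed

lemma hausdorff1_outer_separated:
  assumes "0 < e" "\<And>x y. x \<in> A \<Longrightarrow> y \<in> B \<Longrightarrow> e \<le> dist x y"
  shows "hausdorff1_outer A + hausdorff1_outer B \<le> hausdorff1_outer (A \<union> B)"
proof -
  have *: "hausdorff1_pre \<delta> A + hausdorff1_pre \<delta> B \<le> hausdorff1_pre \<delta> (A \<union> B)" 
    if "0 < \<delta>" "\<delta> < e" for \<delta>
    unfolding hausdorff1_pre_def[of _ "A \<union> B"]
  proof (rule INF_greatest, clarify)
    fix U :: "nat \<Rightarrow> (real^3) set"
    assume U: "\<forall>n. U n \<subseteq> unit_sphere \<and> sphere_diam (U n) \<le> ennreal \<delta>" "A \<union> B \<subseteq> (\<Union>n. U n)"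
    define V where "V X n = (if U n \<inter> X = {} then {} else U n)" for X n
    have [simp]: "sphere_diam {} = 0" by (simp add: sphere_diam_def bot_ennreal)
    have V: "V X n \<subseteq> unit_sphere \<and> sphere_diam (V X n) \<le> ennreal \<delta>" for X n
      using U(1) by (simp add: V_def)
    have le: "hausdorff1_pre \<delta> X \<le> (\<Sum>n. sphere_diam (V X n))" if X: "X \<subseteq> A \<union> B" for X
      unfolding hausdorff1_pre_def
    proof (rule INF_lower, safe)
      fix x assume "x \<in> X"
      then have "x \<in> (\<Union>n. U n)" using U(2) X by blast
      then obtain n where "x \<in> U n" by blast
      then show "x \<in> (\<Union>n. V X n)" using \<open>x \<in> X\<close> by (auto simp: V_def)
    qed (use V in blast)+
    have disj: "U n \<inter> A = {} \<or> U n \<inter> B = {}" for n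
    proof (rule ccontr)
      assume "\<not> ?thesis"
      then obtain x y where xy: "x \<in> U n" "x \<in> A" "y \<in> U n" "y \<in> B" by blast
      have "ennreal (sphere_dist x y) \<le> sphere_diam (U n)"
        unfolding sphere_diam_def by (rule SUP_upper2[of "(x, y)"]) (use xy in auto)
      also have "\<dots> \<le> ennreal \<delta>" using U by blast
      finally have "sphere_dist x y \<le> \<delta>" using \<open>0 < \<delta>\<close> by (simp add: ennreal_le_iff)
      moreover have "e \<le> sphere_dist x y"
        using xy U(1) dist_le_sphere_dist[of x y] assms(2)[of x y] by force
      ultimately show False using \<open>\<delta> < e\<close> by simp
    qed
    have "hausdorff1_pre \<delta> A + hausdorff1_pre \<delta> B \<le>
        (\<Sum>n. sphere_diam (V A n)) + (\<Sum>n. sphere_diam (V B n))"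
      by (intro add_mono le) auto
    also have "\<dots> = (\<Sum>n. sphere_diam (V A n) + sphere_diam (V B n))"
      by (simp add: suminf_add)
    also have "\<dots> \<le> (\<Sum>n. sphere_diam (U n))"
      using disj by (intro suminf_le) (auto simp: V_def)
    finally show "hausdorff1_pre \<delta> A + hausdorff1_pre \<delta> B \<le> (\<Sum>n. sphere_diam (U n))" .
  qed
  have "hausdorff1_pre \<delta> A + hausdorff1_pre \<epsilon> B \<le> hausdorff1_outer (A \<union> B)"
    if "0 < \<delta>" "0 < \<epsilon>" for \<delta> \<epsilon>
  proof -
    define m where "m = min (min \<delta> \<epsilon>) (e/2)"
    have m: "0 < m" "m < e" "m \<le> \<delta>" "m \<le> \<epsilon>" using that assms(1) by (auto simp: m_def)
    have "hausdorff1_pre \<delta> A + hausdorff1_pre \<epsilon> B \<le> hausdorff1_pre m A + hausdorff1_pre m B"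
      using m by (intro add_mono hausdorff1_pre_mono) auto
    also have "\<dots> \<le> hausdorff1_outer (A \<union> B)"
      using *[of m] hausdorff1_pre_le_outer[of m "A \<union> B"] m by (meson order_trans)
    finally show ?thesis .
  qed
  then have le: "hausdorff1_pre \<epsilon> B + hausdorff1_pre \<delta> A \<le> hausdorff1_outer (A \<union> B)"
    if "0 < \<delta>" "0 < \<epsilon>" for \<delta> \<epsilon>
    using that by (simp add: add.commute)
  have "hausdorff1_outer B + hausdorff1_pre \<delta> A =
      (SUP \<epsilon>\<in>{0<..}. hausdorff1_pre \<epsilon> B + hausdorff1_pre \<delta> A)" for \<delta>
    unfolding hausdorff1_outer_def by (rule ennreal_SUP_add_left[symmetric]) simp
  then have le2: "hausdorff1_pre \<delta> A + hausdorff1_outer B \<le> hausdorff1_outer (A \<union> B)" if "0 < \<delta>" for \<delta>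
    using that le by (subst add.commute) (auto intro!: SUP_least)
  have "hausdorff1_outer A + hausdorff1_outer B = (SUP \<delta>\<in>{0<..}. hausdorff1_pre \<delta> A + hausdorff1_outer B)"
    unfolding hausdorff1_outer_def[of A] by (rule ennreal_SUP_add_left[symmetric]) simp
  then show ?thesis
    using le2 by (auto intro!: SUP_least)
qed

lemma hausdorff1_outer_Un: "hausdorff1_outer (A \<union> B) \<le> hausdorff1_outer A + hausdorff1_outer B"
proof -
  have "A \<union> B = (\<Union>i. binaryset A B i)" by (simp add: UN_binaryset_eq)
  then have "hausdorff1_outer (A \<union> B) \<le> (\<Sum>i. hausdorff1_outer (binaryset A B i))"
    using hausdorff1_outer_subadditive[of "binaryset A B"] by simp
  also have "\<dots> = hausdorff1_outer A + hausdorff1_outer B"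
    by (rule suminf_binaryset_eq) (rule hausdorff1_outer_empty)
  finally show ?thesis .
qed

lemma hausdorff1_outer_closed:
  assumes "closed C"
  shows "hausdorff1_outer (X \<inter> C) + hausdorff1_outer (X - C) \<le> hausdorff1_outer X"
proof (cases "C = {} \<or> hausdorff1_outer X = top")
  case True
  then show ?thesis by (auto simp: hausdorff1_outer_empty)
next
  case False
  let ?h = hausdorff1_outer
  define A where "A n = {x \<in> X - C. 1 / (real n + 1) \<le> infdist x C}" for n :: nat
  define D where "D n = A (Suc n) - A n" for n
  have sep: "?h (X \<inter> C) + ?h (A n) \<le> ?h X" for n
  proof -
    have "?h (X \<inter> C) + ?h (A n) \<le> ?h ((X \<inter> C) \<union> A n)"
    proof (rule hausdorff1_outer_separated[of "1 / (real n + 1)"])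
      fix x y assume "x \<in> X \<inter> C" "y \<in> A n"
      then show "1 / (real n + 1) \<le> dist x y"
        using infdist_le[of x C y] by (auto simp: A_def dist_commute)
    qed auto
    also have "\<dots> \<le> ?h X" by (rule hausdorff1_outer_mono) (auto simp: A_def)
    finally show ?thesis .
  qed
  have DD: "?h S + ?h (D k) \<le> ?h (S \<union> D k)" if S: "S \<subseteq> (\<Union>j\<in>{j. j + 2 \<le> k}. D j)" for S k
  proof (cases "k < 2")
    case True
    then show ?thesis using S by (simp add: hausdorff1_outer_empty)
  next
    case False
    have less: "1 / (real k + 1) < 1 / real k" using False by (simp add: field_simps)
    show ?thesis
    proof (rule hausdorff1_outer_separated[of "1 / real k - 1 / (real k + 1)"])
      fix x y assume "x \<in> S" and y: "y \<in> D k"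
      then obtain j where j: "j + 2 \<le> k" "x \<in> D j" using S by auto
      have "1 / real k \<le> 1 / (real (Suc j) + 1)" using j by (simp add: field_simps)
      also have "\<dots> \<le> infdist x C" using j by (auto simp: D_def A_def)
      finally have "1 / real k \<le> infdist x C" .
      moreover have "infdist y C < 1 / (real k + 1)" using y by (auto simp: D_def A_def)
      ultimately show "1 / real k - 1 / (real k + 1) \<le> dist x y"
        using infdist_triangle[of x C y] by simp
    qed (use less in simp)
  qed
  have half: "(\<Sum>i<n. ?h (D (2 * i + s))) \<le> ?h X" for n s
  proof -
    have "(\<Sum>i<n. ?h (D (2 * i + s))) \<le> ?h (\<Union>i<n. D (2 * i + s))"
    proof (induction n)
      case (Suc n)
      have "(\<Sum>i<Suc n. ?h (D (2 * i + s))) \<le> ?h (\<Union>i<n. D (2 * i + s)) + ?h (D (2 * n + s))"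
        using Suc by (simp add: add_right_mono)
      also have "\<dots> \<le> ?h ((\<Union>i<n. D (2 * i + s)) \<union> D (2 * n + s))"
        by (rule DD, intro UN_least, rule UN_upper) simp
      finally show ?case by (simp add: lessThan_Suc Un_commute)
    qed simp
    also have "\<dots> \<le> ?h X" by (rule hausdorff1_outer_mono) (auto simp: D_def A_def)
    finally show ?thesis .
  qed
  have two: "(\<Sum>i<2 * n. ?h (D i)) = (\<Sum>i<n. ?h (D (2 * i + 0))) + (\<Sum>i<n. ?h (D (2 * i + 1)))" for n
    by (induction n) (auto simp: ac_simps)
  have "(\<Sum>i<n. ?h (D i)) \<le> ?h X + ?h X" for n
  proof -
    have "(\<Sum>i<n. ?h (D i)) \<le> (\<Sum>i<2 * n. ?h (D i))" by (rule sum_mono2) auto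
    then show ?thesis unfolding two using half by (meson add_mono order_trans)
  qed
  then have "(\<Sum>i. ?h (D i)) \<le> ?h X + ?h X"
    by (intro suminf_le_const) auto
  also have "\<dots> < top" using False by (simp add: less_top)
  finally have fin: "(\<Sum>i. ?h (D i)) < top" .
  show ?thesis
  proof (rule ennreal_le_epsilon)
    fix e :: real assume e: "0 < e"
    have "\<exists>n. (\<Sum>i. ?h (D (i + n))) \<le> ennreal e"
    proof (cases "(\<Sum>i. ?h (D i)) \<le> ennreal e")
      case True
      then show ?thesis by (intro exI[of _ 0]) simp
    next
      case notle: False
      define T where "T = (\<Sum>i. ?h (D i))"
      have "T - ennreal e < T"
        using fin notle e by (cases T) (auto simp: T_def[symmetric] ennreal_minus ennreal_less_iff not_le)
      then have "T - ennreal e < (SUP n. \<Sum>i<n. ?h (D i))"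
        by (simp add: T_def suminf_eq_SUP)
      then obtain n where n: "T - ennreal e < (\<Sum>i<n. ?h (D i))" (is "_ < ?s")
        by (auto simp: less_SUP_iff)
      have "?s \<le> (\<Sum>i. ?h (D i))" by (rule sum_le_suminf) auto
      then have sfin: "?s < top" using fin by (rule le_less_trans)
      have "?s + (\<Sum>i. ?h (D (i + n))) = T"
        unfolding T_def by (subst suminf_offset[of _ n]) (auto simp: add.commute)
      also have "\<dots> \<le> ?s + ennreal e"
        using n by (metis ennreal_minus_le_iff less_imp_le add.commute)
      finally have "(\<Sum>i. ?h (D (i + n))) \<le> ennreal e"
        using sfin unfolding ennreal_add_left_cancel_le by force
      then show ?thesis ..
    qed
    then obtain n where n: "(\<Sum>i. ?h (D (i + n))) \<le> ennreal e" ..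
    have "X - C \<subseteq> A n \<union> (\<Union>i. D (i + n))"
    proof
      fix x assume x: "x \<in> X - C"
      have "0 < infdist x C"
        using assms False x by (simp add: infdist_pos_not_in_closed)
      then obtain m where "1 / (real m + 1) < infdist x C"
        using reals_Archimedean[of "infdist x C"] by (auto simp: inverse_eq_divide add.commute)
      then have ex: "x \<in> A m" using x by (auto simp: A_def)
      define k where "k = (LEAST k. x \<in> A k)"
      have k: "x \<in> A k" unfolding k_def using ex by (rule LeastI)
      show "x \<in> A n \<union> (\<Union>i. D (i + n))"
      proof (cases "k \<le> n")
        case True
        then have "1 / (real n + 1) \<le> 1 / (real k + 1)" by (simp add: field_simps)
        then show ?thesis using k by (auto simp: A_def)
      next
        case False
        then obtain l where l: "k = Suc l" "n \<le> l" by (cases k) auto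
        then have "x \<notin> A l" using not_less_Least[of l "\<lambda>k. x \<in> A k"] by (simp add: k_def)
        then have "x \<in> D ((l - n) + n)" using k l by (simp add: D_def)
        then show ?thesis by blast
      qed
    qed
    then have "?h (X - C) \<le> ?h (A n \<union> (\<Union>i. D (i + n)))" by (rule hausdorff1_outer_mono)
    also have "\<dots> \<le> ?h (A n) + ?h (\<Union>i. D (i + n))" by (rule hausdorff1_outer_Un)
    also have "\<dots> \<le> ?h (A n) + ennreal e"
      using n hausdorff1_outer_subadditive[of "\<lambda>i. D (i + n)"] by (intro add_left_mono) (rule order_trans)
    finally have "?h (X \<inter> C) + ?h (X - C) \<le> ?h (X \<inter> C) + (?h (A n) + ennreal e)"
      by (rule add_left_mono)
    also have "\<dots> \<le> ?h X + ennreal e"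
      using sep[of n] by (metis add.assoc add_right_mono)
    finally show "?h (X \<inter> C) + ?h (X - C) \<le> ?h X + ennreal e" .
  qed
qed

lemma emeasure_hausdorff1:
  assumes "A \<in> sets borel" "A \<subseteq> unit_sphere"
  shows "emeasure hausdorff1 A = hausdorff1_outer A"
proof -
  define L where "L = lambda_system unit_sphere (Pow unit_sphere) hausdorff1_outer"
  interpret P: sigma_algebra unit_sphere "Pow unit_sphere" by (rule sigma_algebra_Pow)
  have "outer_measure_space (Pow unit_sphere) hausdorff1_outer"
    unfolding outer_measure_space_def positive_def increasing_def countably_subadditive_def
    by (auto simp: hausdorff1_outer_empty intro: hausdorff1_outer_mono hausdorff1_outer_subadditive)
  then have ms: "measure_space unit_sphere L hausdorff1_outer"
    unfolding L_def by (rule P.caratheodory_lemma)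
  then interpret L: sigma_algebra unit_sphere L by (simp add: measure_space_def)
  have closed: "unit_sphere \<inter> C \<in> L" if "closed C" for C
  proof -
    have "hausdorff1_outer (X \<inter> (unit_sphere \<inter> C)) + hausdorff1_outer (X - (unit_sphere \<inter> C)) =
        hausdorff1_outer X" if "X \<subseteq> unit_sphere" for X
    proof -
      have eq: "X \<inter> (unit_sphere \<inter> C) = X \<inter> C" "X - (unit_sphere \<inter> C) = X - C" using that by auto
      have "hausdorff1_outer X \<le> hausdorff1_outer (X \<inter> C) + hausdorff1_outer (X - C)"
        using hausdorff1_outer_Un[of "X \<inter> C" "X - C"] by (simp add: Un_Diff_Int Un_commute)
      then show ?thesis unfolding eq using hausdorff1_outer_closed[OF \<open>closed C\<close>] by (rule antisym[rotated])
    qed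
    then show ?thesis by (simp add: L_def P.lambda_system_eq)
  qed
  have borel: "unit_sphere \<inter> B \<in> L" if "B \<in> sets borel" for B
  proof -
    have "B \<in> sigma_sets UNIV (Collect closed)" using that by (simp add: borel_eq_closed)
    then show ?thesis
    proof induction
      case (Compl a)
      have "unit_sphere \<inter> (UNIV - a) = unit_sphere - unit_sphere \<inter> a" by blast
      then show ?case using Compl by (metis L.compl_sets)
    next
      case (Union a)
      have "unit_sphere \<inter> (\<Union>i. a i) = (\<Union>i. unit_sphere \<inter> a i)" by blast
      then show ?case using Union L.countable_UN[of "\<lambda>i. unit_sphere \<inter> a i" UNIV] by auto
    qed (use closed in auto)
  qed
  define R where "R = sets (restrict_space borel unit_sphere)"
  have RL: "R \<subseteq> L" unfolding R_def sets_restrict_space using borel by auto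
  have "sigma_algebra unit_sphere R"
    using sets.sigma_algebra_axioms[of "restrict_space borel unit_sphere"]
    by (simp add: R_def space_restrict_space)
  moreover have "positive R hausdorff1_outer"
    by (simp add: positive_def hausdorff1_outer_empty)
  moreover have "countably_additive R hausdorff1_outer"
    using ms RL unfolding measure_space_def countably_additive_def by blast
  moreover have "A \<in> R" using assms by (auto simp: R_def sets_restrict_space)
  ultimately show ?thesis
    unfolding hausdorff1_def R_def[symmetric] by (rule emeasure_measure_of_sigma)
qed


section \<open>Periodic broken rays\<close>

text \<open>The Levi-Civita connection of the induced metric is the tangential part of the Euclidean
  derivative, so a curve on the sphere is a geodesic iff its acceleration is everywhere orthogonal
  to the tangent space, which at \<open>p\<close> consists of the \<open>u\<close> with \<open>u \<bullet> p = 0\<close>. Constant curves are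
  excluded; the constant speed of a geodesic is otherwise arbitrary.\<close>

definition sphere_geodesic_on :: "real set \<Rightarrow> (real \<Rightarrow> real^3) \<Rightarrow> bool" where
  "sphere_geodesic_on I c \<longleftrightarrow>
     (\<exists>c' c''. \<forall>t\<in>I. c t \<in> unit_sphere \<and>
        (c has_vector_derivative c' t) (at t within I) \<and> c' t \<noteq> 0 \<and>
        (c' has_vector_derivative c'' t) (at t within I) \<and>
        (\<forall>u. u \<bullet> c t = 0 \<longrightarrow> c'' t \<bullet> u = 0))"

definition reflect :: "real^3 \<Rightarrow> real^3 \<Rightarrow> real^3" where
  "reflect \<nu> v = v - (2 * (v \<bullet> \<nu>)) *\<^sub>R \<nu>"

text \<open>At \<open>t\<close> the curve hits an open face, its incoming velocity \<open>v\<close> is not tangent to that face,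
  and its outgoing velocity is the mirror image of \<open>v\<close>.\<close>

definition reflects_at :: "(real \<Rightarrow> real^3) \<Rightarrow> real \<Rightarrow> bool" where
  "reflects_at c t \<longleftrightarrow>
     (\<exists>i \<epsilon> v. 0 < \<epsilon> \<and> c t \<in> octant_face i \<and>
        sphere_geodesic_on {t - \<epsilon>..t} c \<and> sphere_geodesic_on {t..t + \<epsilon>} c \<and>
        v \<bullet> axis i 1 \<noteq> 0 \<and>
        (c has_vector_derivative v) (at t within {t - \<epsilon>..t}) \<and>
        (c has_vector_derivative reflect (axis i 1) v) (at t within {t..t + \<epsilon>}))"

definition geodesic_at :: "(real \<Rightarrow> real^3) \<Rightarrow> real \<Rightarrow> bool" where
  "geodesic_at c t \<longleftrightarrow>
     c t \<in> octant_interior \<and> (\<exists>\<epsilon>>0. sphere_geodesic_on {t - \<epsilon>..t + \<epsilon>} c)"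

text \<open>Every parameter has a neighbourhood that contains at most one reflection, so by compactness
  there are finitely many reflections in each period. Rays do not run into corners, where the
  reflection law has no meaning.\<close>

definition periodic_broken_rays :: "(real \<Rightarrow> real^3) set" where
  "periodic_broken_rays =
     {c. range c \<subseteq> octant \<and> (\<exists>T>0. \<forall>t. c (t + T) = c t) \<and>
         (\<forall>t. geodesic_at c t \<or> reflects_at c t)}"

definition periodic_broken_ray_transform ::
    "(real^3 \<Rightarrow> real) \<Rightarrow> (real \<Rightarrow> real^3) \<Rightarrow> real" where
  "periodic_broken_ray_transform f =
     restrict (\<lambda>c. LINT x:range c|hausdorff1. f x) periodic_broken_rays"


section \<open>Smooth functions with vanishing odd normal derivatives\<close>

primrec Ck_on :: "nat \<Rightarrow> (real^3 \<Rightarrow> real) \<Rightarrow> (real^3) set \<Rightarrow> bool" where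
  "Ck_on 0 F U \<longleftrightarrow> continuous_on U F"
| "Ck_on (Suc k) F U \<longleftrightarrow>
     F differentiable_on U \<and> (\<forall>u. Ck_on k (\<lambda>x. frechet_derivative F (at x) u) U)"

definition smooth_on_octant :: "(real^3 \<Rightarrow> real) \<Rightarrow> bool" where
  "smooth_on_octant f \<longleftrightarrow>
     (\<forall>p\<in>octant. \<exists>U F. open U \<and> p \<in> U \<and> (\<forall>k. Ck_on k F U) \<and> (\<forall>x\<in>U \<inter> octant. F x = f x))"

text \<open>The \<open>k\<close>-th normal derivative at \<open>x\<close> in the face \<open>i\<close> is the \<open>k\<close>-th (one-sided) derivative of \<open>f\<close>
  along the unit speed geodesic that starts at \<open>x\<close> in the direction of the inward normal; this
  geodesic stays in the octant up to the parameter \<open>pi / 2\<close>.\<close>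

definition normal_derivative :: "nat \<Rightarrow> 3 \<Rightarrow> (real^3 \<Rightarrow> real) \<Rightarrow> real^3 \<Rightarrow> real" where
  "normal_derivative k i f x =
     ((\<lambda>g t. vector_derivative g (at t within {0..pi / 2})) ^^ k)
       (\<lambda>t. f (cos t *\<^sub>R x + sin t *\<^sub>R axis i 1)) 0"

text \<open>Functions on the octant are represented by functions that are \<^const>\<open>undefined\<close> outside it.
  At the corners the vanishing of the normal derivatives follows from the faces by continuity.\<close>

definition admissible_functions :: "(real^3 \<Rightarrow> real) set" where
  "admissible_functions =
     {f \<in> extensional octant. smooth_on_octant f \<and>
        (\<forall>k i. odd k \<longrightarrow> (\<forall>x\<in>octant_face i. normal_derivative k i f x = 0))}"

end

theory Submission
  imports Defs
begin

text \<open>Extend a function \<open>f\<close> on the octant to the whole sphere by \<open>F x = f \<bar>x\<bar>\<close>, the absolute value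
  being taken in each coordinate. Off the coordinate planes the folding map
  \<open>x \<mapsto> \<bar>x\<bar>\<close> is locally a fixed change of signs, and where a path crosses one of these planes the
  change of signs is composed with the reflection in that plane. So folding maps a great circle that
  avoids the corners \<open>\<plusminus> axis i 1\<close> to a periodic broken ray (lemma
  \<open>fold_great_circle_periodic_broken_ray\<close>). Antipodal points have the same image, and apart from
  finitely many points this is the only coincidence. Hence the integral of \<open>f\<close> over the trace is the
  integral of \<open>F\<close> over half of the great circle (lemma \<open>integral_over_folded_trace\<close>). It therefore
  suffices to show that a continuous function on the sphere vanishes if its integrals over all great
  semicircles vanish, which for even functions is the injectivity of the Funk transform (lemma
  \<open>funk_transform_injective\<close>); the great circles through corners are limits of the others.

  The Hausdorff measure of the trace is computed on each of the eight pieces of the semicircle on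
  which the signs of the coordinates are fixed. There folding is an isometry, so the curve preserves
  distances, and a distance-preserving image of an interval carries the transported Lebesgue measure.

  For the Funk transform, fix a point \<open>p\<close> and let \<open>M s\<close> be the integral of \<open>F\<close> over the parallel
  circle at height \<open>s\<close> above the equator of \<open>p\<close>. All great semicircles that start on the equator and
  rise to the same maximal height \<open>s\<close> arise from one of them by rotation about \<open>p\<close>; integrating over
  this rotation gives \<open>integral {0..pi} (\<lambda>\<phi>. M (s * sin \<phi>)) = 0\<close> for all \<open>s\<close> in the unit interval.
  This is an Abel equation. It is solved by substituting \<open>s = u * sin \<theta>\<close> and integrating against
  \<open>sin \<theta>\<close>: then \<open>\<theta>\<close> and \<open>\<phi>\<close> are spherical coordinates on a hemisphere, \<open>sin \<theta> * sin \<phi>\<close> is one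
  Cartesian coordinate, and by the hat-box theorem of Archimedes that coordinate is uniformly
  distributed. So the integral of \<open>M\<close> from \<open>0\<close> to \<open>u\<close> vanishes for all \<open>u\<close>, hence \<open>M = 0\<close>, and
  \<open>M 1 = 2 * pi * F p\<close>.\<close>


section \<open>Hausdorff measure of arcs of great circles\<close>

lemma sets_hausdorff1: "sets hausdorff1 = sets (restrict_space borel unit_sphere)"
  unfolding hausdorff1_def
  by (metis sets.sets_measure_of_eq space_restrict_space Int_UNIV_right space_borel)

lemma space_hausdorff1: "space hausdorff1 = unit_sphere"
  using sets_eq_imp_space_eq[OF sets_hausdorff1] by (simp add: space_restrict_space)

text \<open>A covering set of diameter \<open>d\<close> meets the curve in parameters that lie in an interval of length at
  most \<open>d\<close>, because the curve does not shrink distances. So every covering of the image yields a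
  covering of the parameter set by intervals, of no larger total length.\<close>

lemma lebesgue_le_hausdorff1_pre:
  fixes \<gamma> :: "real \<Rightarrow> real^3"
  assumes expand: "\<And>s t. s \<in> {0..L} \<Longrightarrow> t \<in> {0..L} \<Longrightarrow> \<bar>s - t\<bar> \<le> sphere_dist (\<gamma> s) (\<gamma> t)"
    and B: "B \<in> sets borel" "B \<subseteq> {0..L}"
  shows "emeasure lborel B \<le> hausdorff1_pre \<delta> (\<gamma> ` B)"
  unfolding hausdorff1_pre_def
proof (rule INF_greatest, clarify)
  fix U :: "nat \<Rightarrow> (real^3) set"
  assume U: "\<gamma> ` B \<subseteq> (\<Union>n. U n)"
  define W where "W n = {t \<in> {0..L}. \<gamma> t \<in> U n}" for n
  define V where "V n = (if W n = {} then {} else {Inf (W n)..Sup (W n)})" for n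
  have bdd: "bdd_below (W n)" "bdd_above (W n)" for n
    by (auto simp: W_def intro!: bdd_belowI[of _ 0] bdd_aboveI[of _ L])
  have WV: "W n \<subseteq> V n" for n
    using bdd[of n] by (auto simp: V_def intro: cInf_lower cSup_upper)
  have len: "emeasure lborel (V n) \<le> sphere_diam (U n)" for n
  proof (cases "W n = {}")
    case True
    then show ?thesis by (simp add: V_def)
  next
    case ne: False
    show ?thesis
    proof (cases "sphere_diam (U n)")
      case (real d)
      have diam: "t \<le> s + d" if "s \<in> W n" "t \<in> W n" for s t
      proof -
        have "ennreal (sphere_dist (\<gamma> s) (\<gamma> t)) \<le> sphere_diam (U n)"
          unfolding sphere_diam_def
          by (rule SUP_upper2[of "(\<gamma> s, \<gamma> t)"]) (use that in \<open>auto simp: W_def\<close>)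
        then have "sphere_dist (\<gamma> s) (\<gamma> t) \<le> d" using real by (simp add: ennreal_le_iff)
        then show ?thesis using expand[of s t] that by (auto simp: W_def)
      qed
      have "Sup (W n) \<le> Inf (W n) + d"
      proof (rule cSup_least[OF ne])
        fix t assume "t \<in> W n"
        then have "t - d \<le> Inf (W n)"
          using diam by (intro cInf_greatest[OF ne]) (simp add: algebra_simps)
        then show "t \<le> Inf (W n) + d" by simp
      qed
      moreover have "Inf (W n) \<le> Sup (W n)"
        by (intro cInf_le_cSup ne bdd)
      ultimately show ?thesis using real ne by (simp add: V_def ennreal_leI)
    qed simp
  qed
  have "B \<subseteq> (\<Union>n. W n)"
  proof
    fix t assume "t \<in> B"
    then have "\<gamma> t \<in> (\<Union>n. U n)" "t \<in> {0..L}" using U B(2) by blast+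
    then show "t \<in> (\<Union>n. W n)" by (simp add: W_def)
  qed
  also have "\<dots> \<subseteq> (\<Union>n. V n)" using WV by blast
  finally have "emeasure lborel B \<le> emeasure lborel (\<Union>n. V n)"
    by (rule emeasure_mono) (auto simp: V_def)
  also have "\<dots> \<le> (\<Sum>n. emeasure lborel (V n))"
    by (rule emeasure_subadditive_countably) (auto simp: V_def)
  also have "\<dots> \<le> (\<Sum>n. sphere_diam (U n))"
    by (intro suminf_le len) auto
  finally show "emeasure lborel B \<le> (\<Sum>n. sphere_diam (U n))" .
qed

lemma hausdorff1_outer_curve_le:
  fixes \<gamma> :: "real \<Rightarrow> real^3"
  assumes sphere: "\<gamma> \<in> {0..L} \<rightarrow> unit_sphere"
    and short: "\<And>s t. s \<in> {0..L} \<Longrightarrow> t \<in> {0..L} \<Longrightarrow> sphere_dist (\<gamma> s) (\<gamma> t) \<le> \<bar>s - t\<bar>"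
    and "0 \<le> L"
  shows "hausdorff1_outer (\<gamma> ` {0..L}) \<le> ennreal L"
  unfolding hausdorff1_outer_def
proof (rule SUP_least)
  fix \<delta> :: real assume "\<delta> \<in> {0<..}"
  then have "0 < \<delta>" by simp
  \<comment> \<open>cut the parameter interval into \<open>N\<close> equal pieces shorter than \<open>\<delta>\<close>\<close>
  obtain N :: nat where N: "L / \<delta> < real N" using reals_Archimedean2 by blast
  have "0 \<le> L / \<delta>" using \<open>0 < \<delta>\<close> \<open>0 \<le> L\<close> by simp
  with N have N0: "0 < real N" by linarith
  have h\<delta>: "L / N \<le> \<delta>" using N N0 \<open>0 < \<delta>\<close> by (simp add: field_simps)
  define J where "J k = {L * real k / N..L * (real k + 1) / N}" for k :: nat
  define U where "U k = (if k < N then \<gamma> ` J k else {})" for k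
  have J: "J k \<subseteq> {0..L}" if "k < N" for k
  proof -
    have "L * (real k + 1) \<le> L * N" using that \<open>0 \<le> L\<close> by (intro mult_left_mono) auto
    then have le: "L * (real k + 1) / N \<le> L" using N0 by (simp add: field_simps)
    have "0 \<le> L * k / N" using \<open>0 \<le> L\<close> by simp
    then show ?thesis using le by (auto simp: J_def algebra_simps intro: order_trans)
  qed
  have diam: "sphere_diam (U k) \<le> (if k < N then ennreal (L / N) else 0)" for k
  proof (cases "k < N")
    case True
    have "sphere_dist (\<gamma> s) (\<gamma> t) \<le> L / N" if "s \<in> J k" "t \<in> J k" for s t
    proof -
      have "\<bar>s - t\<bar> \<le> L * (real k + 1) / N - L * real k / N"
        using that unfolding J_def atLeastAtMost_iff by linarith
      also have "\<dots> = L / N" using N0 by (simp add: field_simps)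
      finally show ?thesis using short[of s t] J[OF True] that by force
    qed
    then show ?thesis using True by (auto simp: U_def sphere_diam_def intro!: SUP_least ennreal_leI)
  qed (simp add: U_def sphere_diam_def bot_ennreal)
  have "hausdorff1_pre \<delta> (\<gamma> ` {0..L}) \<le> (\<Sum>k. sphere_diam (U k))"
    unfolding hausdorff1_pre_def
  proof (rule INF_lower, safe)
    fix k x assume "x \<in> U k"
    then show "x \<in> unit_sphere" using sphere J[of k] by (auto simp: U_def split: if_splits)
  next
    fix k
    have "(if k < N then ennreal (L / N) else 0) \<le> ennreal \<delta>"
      using h\<delta> \<open>0 < \<delta>\<close> by (auto intro: ennreal_leI)
    then show "sphere_diam (U k) \<le> ennreal \<delta>" using diam[of k] by (rule order_trans[rotated])
  next
    fix t assume t: "t \<in> {0..L}"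
    show "\<gamma> t \<in> (\<Union>k. U k)"
    proof (cases "t = L")
      case True
      have "L * real (N - 1) / N \<le> L" "L \<le> L * (real (N - 1) + 1) / N"
        using N0 \<open>0 \<le> L\<close> by (auto simp: field_simps of_nat_diff)
      then have "t \<in> J (N - 1)" unfolding J_def True atLeastAtMost_iff by blast
      then show ?thesis using N0 by (intro UN_I[of "N - 1"]) (auto simp: U_def)
    next
      case False
      then have "0 < L" "t < L" "0 \<le> t" using t by auto
      define k where "k = nat \<lfloor>t * N / L\<rfloor>"
      have "real k \<le> t * N / L" "t * N / L < real k + 1"
        using \<open>0 \<le> t\<close> \<open>0 < L\<close> by (auto simp: k_def)
      moreover from this have "real k < N"
      proof -
        have "t * N / L < N" using \<open>t < L\<close> \<open>0 < L\<close> N0 by (simp add: field_simps)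
        then show ?thesis using \<open>real k \<le> t * N / L\<close> by linarith
      qed
      ultimately have "t \<in> J k" "k < N" using \<open>0 < L\<close> N0 by (auto simp: J_def field_simps)
      then show ?thesis by (intro UN_I[of k]) (auto simp: U_def)
    qed
  qed
  also have "\<dots> \<le> (\<Sum>k. if k < N then ennreal (L / N) else 0)"
    by (intro suminf_le diam) auto
  also have "\<dots> = (\<Sum>k<N. ennreal (L / N))"
    by (subst suminf_finite[of "{..<N}"]) auto
  also have "\<dots> = ennreal L"
    using N0 \<open>0 \<le> L\<close> by (simp add: ennreal_of_nat_eq_real_of_nat flip: ennreal_mult)
  finally show "hausdorff1_pre \<delta> (\<gamma> ` {0..L}) \<le> ennreal L" .
qed

text \<open>Distance-preserving curves are the minimizing geodesics of unit speed. Along them coverings of the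
  curve and coverings of the parameter interval correspond to each other.\<close>

locale spherical_segment =
  fixes L :: real and \<gamma> :: "real \<Rightarrow> real^3"
  assumes nonneg: "0 \<le> L"
    and on_sphere: "t \<in> {0..L} \<Longrightarrow> \<gamma> t \<in> unit_sphere"
    and isometric: "s \<in> {0..L} \<Longrightarrow> t \<in> {0..L} \<Longrightarrow> sphere_dist (\<gamma> s) (\<gamma> t) = \<bar>s - t\<bar>"
begin

lemma continuous: "continuous_on {0..L} \<gamma>"
proof -
  have "dist (\<gamma> t) (\<gamma> s) \<le> dist t s" if "s \<in> {0..L}" "t \<in> {0..L}" for s t
    using dist_le_sphere_dist[of "\<gamma> t" "\<gamma> s"] on_sphere isometric that
    by (auto simp: dist_real_def)
  then show ?thesis
    unfolding continuous_on_iff by (meson order_le_less_trans)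
qed

lemma inj: "inj_on \<gamma> {0..L}"
proof
  fix s t assume st: "s \<in> {0..L}" "t \<in> {0..L}" "\<gamma> s = \<gamma> t"
  then have "\<bar>s - t\<bar> = \<bar>s - s\<bar>"
    using isometric[of s t] isometric[of s s] by simp
  then show "s = t" by simp
qed

lemma borel_preimage:
  assumes "A \<in> sets borel"
  shows "{t \<in> {0..L}. \<gamma> t \<in> A} \<in> sets borel"
proof -
  have "\<gamma> \<in> borel_measurable (restrict_space borel {0..L})"
    using continuous by (rule borel_measurable_continuous_on_restrict)
  from measurable_sets[OF this assms] show ?thesis
    by (auto simp: space_restrict_space sets_restrict_space_iff Int_def vimage_def conj_commute)
qed

lemma borel_image: "\<gamma> ` {0..L} \<in> sets borel"
  by (intro borel_compact compact_continuous_image continuous compact_Icc)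

lemma arc_subset: "\<gamma> ` {0..L} \<subseteq> unit_sphere"
  using on_sphere by blast

text \<open>The covering argument bounds the Hausdorff measure of every Borel piece of the arc from below by the
  Lebesgue measure, while the whole arc has measure at most \<open>L\<close>. Applying the lower bound to a piece
  and to its complement leaves no room for a strict inequality.\<close>

lemma emeasure_arc:
  assumes A: "A \<in> sets borel"
  shows "emeasure hausdorff1 (\<gamma> ` {0..L} \<inter> A) = emeasure lborel {t \<in> {0..L}. \<gamma> t \<in> A}"
proof -
  let ?P = "\<lambda>A. {t \<in> {0..L}. \<gamma> t \<in> A}" and ?H = "\<lambda>A. emeasure hausdorff1 (\<gamma> ` {0..L} \<inter> A)"
  have lower: "emeasure lborel (?P A) \<le> ?H A" if A: "A \<in> sets borel" for A
  proof -
    have "emeasure lborel (?P A) \<le> hausdorff1_pre 1 (\<gamma> ` ?P A)"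
      using borel_preimage[OF A] by (intro lebesgue_le_hausdorff1_pre) (auto simp: isometric)
    also have "\<dots> \<le> hausdorff1_outer (\<gamma> ` ?P A)" by (rule hausdorff1_pre_le_outer) simp
    also have "\<gamma> ` ?P A = \<gamma> ` {0..L} \<inter> A" by auto
    also have "hausdorff1_outer \<dots> = ?H A"
      using A borel_image on_sphere by (intro emeasure_hausdorff1[symmetric]) auto
    finally show ?thesis .
  qed
  have sets: "\<gamma> ` {0..L} \<inter> B \<in> sets hausdorff1" if "B \<in> sets borel" for B
    using that borel_image arc_subset by (auto simp: sets_hausdorff1 sets_restrict_space_iff)
  have "?H A + ?H (- A) = emeasure hausdorff1 ((\<gamma> ` {0..L} \<inter> A) \<union> (\<gamma> ` {0..L} \<inter> - A))"
    using A by (intro plus_emeasure sets) auto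
  also have "(\<gamma> ` {0..L} \<inter> A) \<union> (\<gamma> ` {0..L} \<inter> - A) = \<gamma> ` {0..L}" by blast
  also have "emeasure hausdorff1 (\<gamma> ` {0..L}) = hausdorff1_outer (\<gamma> ` {0..L})"
    using borel_image arc_subset by (intro emeasure_hausdorff1)
  also have "\<dots> \<le> ennreal L"
    using on_sphere nonneg by (intro hausdorff1_outer_curve_le) (auto simp: isometric)
  also have "\<dots> = emeasure lborel (?P A \<union> ?P (- A))"
  proof -
    have "?P A \<union> ?P (- A) = {0..L}" by auto
    then show ?thesis using nonneg by simp
  qed
  also have "\<dots> = emeasure lborel (?P A) + emeasure lborel (?P (- A))"
    using A borel_preimage[of A] borel_preimage[of "- A"] by (intro plus_emeasure[symmetric]) auto
  finally have le: "?H A + ?H (- A) \<le> emeasure lborel (?P A) + emeasure lborel (?P (- A))" .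
  have fin: "emeasure lborel (?P (- A)) \<noteq> top"
  proof -
    have "emeasure lborel (?P (- A)) \<le> emeasure lborel {0..L}" by (rule emeasure_mono) auto
    then show ?thesis using nonneg by (auto simp: top_unique)
  qed
  have "emeasure lborel (?P (- A)) + ?H A \<le> ?H (- A) + ?H A"
    using A by (intro add_right_mono lower) auto
  also have "\<dots> \<le> emeasure lborel (?P (- A)) + emeasure lborel (?P A)"
    using le by (simp only: add.commute)
  finally have "?H A \<le> emeasure lborel (?P A)"
    using fin by (simp only: ennreal_add_left_cancel_le) auto
  then show ?thesis using lower[OF A] by (rule antisym)
qed

lemma sets_arc: "\<gamma> ` {0..L} \<in> sets hausdorff1"
  using borel_image arc_subset by (simp add: sets_hausdorff1 sets_restrict_space_iff)

lemma measurable_arc: "\<gamma> \<in> measurable (restrict_space lborel {0..L}) hausdorff1"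
proof (rule measurableI)
  fix A assume "A \<in> sets hausdorff1"
  then have "A \<in> sets borel" by (auto simp: sets_hausdorff1 sets_restrict_space_iff)
  moreover have "\<gamma> -` A \<inter> space (restrict_space lborel {0..L}) = {t \<in> {0..L}. \<gamma> t \<in> A}"
    by (auto simp: space_restrict_space)
  ultimately show "\<gamma> -` A \<inter> space (restrict_space lborel {0..L}) \<in> sets (restrict_space lborel {0..L})"
    using borel_preimage[of A] by (auto simp: sets_restrict_space_iff)
qed (use on_sphere in \<open>auto simp: space_restrict_space space_hausdorff1\<close>)

text \<open>On the arc the Hausdorff measure is the transported Lebesgue measure; in this form integrals can
  be transported as well.\<close>

lemma density_arc:
  "density hausdorff1 (indicator (\<gamma> ` {0..L})) = distr (restrict_space lborel {0..L}) hausdorff1 \<gamma>"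
  (is "?D = distr ?R _ _")
proof (rule measure_eqI)
  fix A assume "A \<in> sets ?D"
  then have A: "A \<in> sets hausdorff1" by simp
  then have borel: "A \<in> sets borel"
    by (auto simp: sets_hausdorff1 sets_restrict_space_iff)
  have "emeasure ?D A = emeasure lborel {t \<in> {0..L}. \<gamma> t \<in> A}"
    using emeasure_arc[OF borel] by (simp add: emeasure_restricted[OF sets_arc A])
  also have "\<dots> = emeasure ?R {t \<in> {0..L}. \<gamma> t \<in> A}"
    by (rule emeasure_restrict_space[symmetric]) auto
  also have "\<dots> = emeasure (distr ?R hausdorff1 \<gamma>) A"
    by (subst emeasure_distr[OF measurable_arc A])
       (auto simp: space_restrict_space intro!: arg_cong[where f = "emeasure ?R"])
  finally show "emeasure ?D A = emeasure (distr ?R hausdorff1 \<gamma>) A" .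
qed simp

lemma set_integral_arc:
  fixes f :: "real^3 \<Rightarrow> real"
  assumes D: "compact D" "D \<subseteq> {0..L}" and f: "continuous_on (\<gamma> ` D) f"
  shows "set_integrable hausdorff1 (\<gamma> ` D) f"
    and "(LINT x:\<gamma> ` D|hausdorff1. f x) = (LINT t:D|lborel. f (\<gamma> t))"
proof -
  let ?h = "\<lambda>x. indicator (\<gamma> ` D) x *\<^sub>R f x" and ?R = "restrict_space lborel {0..L}"
  have contD: "continuous_on D \<gamma>" using continuous D(2) by (rule continuous_on_subset)
  have "?h \<in> borel_measurable borel"
    using compact_continuous_image[OF contD D(1)] f
    by (intro borel_measurable_continuous_on_indicator) (auto intro: borel_compact)
  then have h: "?h \<in> borel_measurable hausdorff1"
    using measurable_restrict_space1 measurable_cong_sets[OF sets_hausdorff1 refl] by blast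
  have ind: "indicator (\<gamma> ` {0..L}) x *\<^sub>R ?h x = ?h x" for x
    using D(2) by (auto simp: indicator_def)
  have pull: "indicator {0..L} t *\<^sub>R ?h (\<gamma> t) = indicator D t *\<^sub>R f (\<gamma> t)" for t
    using inj_on_image_mem_iff[OF inj _ D(2), of t] D(2) by (cases "t \<in> {0..L}") (auto simp: indicator_def)
  have dens: "density hausdorff1 (\<lambda>x. ennreal (indicator (\<gamma> ` {0..L}) x)) = distr ?R hausdorff1 \<gamma>"
    using density_arc by (simp add: ennreal_indicator)
  have "integrable hausdorff1 ?h \<longleftrightarrow> integrable (distr ?R hausdorff1 \<gamma>) ?h"
    unfolding dens[symmetric] using h sets_arc by (subst integrable_density) (simp_all only: ind, auto)
  also have "\<dots> \<longleftrightarrow> integrable ?R (\<lambda>t. ?h (\<gamma> t))"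
    by (rule integrable_distr_eq[OF measurable_arc h])
  also have "\<dots> \<longleftrightarrow> integrable lborel (\<lambda>t. indicator D t *\<^sub>R f (\<gamma> t))"
    by (subst integrable_restrict_space) (simp_all only: pull, auto)
  finally show "set_integrable hausdorff1 (\<gamma> ` D) f"
    using borel_integrable_compact[OF D(1) continuous_on_compose[OF contD f]]
    by (simp add: set_integrable_def o_def)
  have "integral\<^sup>L hausdorff1 ?h = integral\<^sup>L (distr ?R hausdorff1 \<gamma>) ?h"
    unfolding dens[symmetric] using h sets_arc by (subst integral_density) (simp_all only: ind, auto)
  also have "\<dots> = integral\<^sup>L ?R (\<lambda>t. ?h (\<gamma> t))"
    by (rule integral_distr[OF measurable_arc h])
  also have "\<dots> = integral\<^sup>L lborel (\<lambda>t. indicator D t *\<^sub>R f (\<gamma> t))"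
    by (subst integral_restrict_space) (simp_all only: pull, auto)
  finally show "(LINT x:\<gamma> ` D|hausdorff1. f x) = (LINT t:D|lborel. f (\<gamma> t))"
    by (simp add: set_lebesgue_integral_def)
qed

lemma finite_image_null:
  assumes "finite Z" "Z \<subseteq> {0..L}"
  shows "\<gamma> ` Z \<in> null_sets hausdorff1"
proof -
  have "finite (\<gamma> ` Z)" using assms(1) by simp
  then have borel: "\<gamma> ` Z \<in> sets borel" by (simp add: borel_closed finite_imp_closed)
  have "{t \<in> {0..L}. \<gamma> t \<in> \<gamma> ` Z} = Z"
    using inj_on_image_mem_iff[OF inj _ assms(2)] assms(2) by blast
  then have "emeasure hausdorff1 (\<gamma> ` {0..L} \<inter> \<gamma> ` Z) = 0"
    using emeasure_arc[OF borel] finite_imp_null_set_lborel[OF assms(1)] by auto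
  moreover have sub: "\<gamma> ` Z \<subseteq> \<gamma> ` {0..L}" using assms(2) by blast
  ultimately have "emeasure hausdorff1 (\<gamma> ` Z) = 0" by (simp add: Int_absorb1)
  moreover have "\<gamma> ` Z \<in> sets hausdorff1"
    using borel sub arc_subset by (auto simp: sets_hausdorff1 sets_restrict_space_iff)
  ultimately show ?thesis by blast
qed

end


section \<open>Great circles folded into the octant\<close>

definition orthonormal :: "real^3 \<Rightarrow> real^3 \<Rightarrow> bool" where
  "orthonormal a b \<longleftrightarrow> norm a = 1 \<and> norm b = 1 \<and> a \<bullet> b = 0"

definition great_circle :: "real^3 \<Rightarrow> real^3 \<Rightarrow> real \<Rightarrow> real^3" where
  "great_circle a b t = cos t *\<^sub>R a + sin t *\<^sub>R b"

text \<open>The sign pattern is a function between finite types, so that sums over all eight patterns make sense.\<close>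

definition flip :: "(3 \<Rightarrow> bool) \<Rightarrow> real^3 \<Rightarrow> real^3" where
  "flip \<sigma> x = (\<chi> i. if \<sigma> i then x $ i else - x $ i)"

definition fold_octant :: "real^3 \<Rightarrow> real^3" where
  "fold_octant x = (\<chi> i. \<bar>x $ i\<bar>)"

lemma orthonormal_inner:
  "orthonormal a b \<longleftrightarrow> a \<bullet> a = 1 \<and> b \<bullet> b = 1 \<and> a \<bullet> b = 0 \<and> b \<bullet> a = 0"
  by (auto simp: orthonormal_def norm_eq_1 inner_commute)

lemma great_circle_inner:
  assumes "orthonormal a b"
  shows "great_circle a b s \<bullet> great_circle a b t = cos (s - t)"
  using assms by (simp add: orthonormal_inner great_circle_def inner_simps cos_diff)

lemma norm_great_circle: "orthonormal a b \<Longrightarrow> norm (great_circle a b t) = 1"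
  by (simp add: norm_eq_1 great_circle_inner)

lemma great_circle_add:
  "great_circle a b (t + h) = great_circle (great_circle a b t) (great_circle b (- a) t) h"
  by (simp add: great_circle_def cos_add sin_add algebra_simps)

lemma great_circle_2pi: "great_circle a b (t + 2 * pi) = great_circle a b t"
  by (simp add: great_circle_def)

lemma orthonormal_great_circle:
  "orthonormal a b \<Longrightarrow> orthonormal (great_circle a b t) (great_circle b (- a) t)"
  by (simp add: orthonormal_inner great_circle_def inner_simps algebra_simps)

lemma great_circle_has_vector_derivative:
  "(great_circle a b has_vector_derivative great_circle b (- a) t) (at t within I)"
  unfolding great_circle_def
  by (auto intro!: derivative_eq_intros simp: has_real_derivative_iff_has_vector_derivative[symmetric])

lemma continuous_on_great_circle: "continuous_on I (great_circle a b)"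
  unfolding great_circle_def by (intro continuous_intros)

lemma sphere_geodesic_on_great_circle:
  assumes ab: "orthonormal a b" and c: "\<And>t. t \<in> I \<Longrightarrow> c t = great_circle a b t"
  shows "sphere_geodesic_on I c"
  unfolding sphere_geodesic_on_def
proof (intro exI ballI conjI allI impI)
  fix t u assume t: "t \<in> I"
  show "c t \<in> unit_sphere" using ab t by (simp add: c norm_great_circle)
  show "(c has_vector_derivative great_circle b (- a) t) (at t within I)"
    by (rule has_vector_derivative_transform[OF t c great_circle_has_vector_derivative])
  have "norm (great_circle b (- a) t) = 1"
    using orthonormal_great_circle[OF ab] by (simp add: orthonormal_def)
  then show "great_circle b (- a) t \<noteq> 0" by auto
  show "(great_circle b (- a) has_vector_derivative great_circle (- a) (- b) t) (at t within I)"
    by (rule great_circle_has_vector_derivative)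
  have "great_circle (- a) (- b) t = - c t" using t by (simp add: c great_circle_def)
  then show "u \<bullet> c t = 0 \<Longrightarrow> great_circle (- a) (- b) t \<bullet> u = 0" by (simp add: inner_commute)
qed

lemma flip_inner: "flip \<sigma> x \<bullet> flip \<sigma> y = x \<bullet> y"
  unfolding inner_vec_def by (intro sum.cong) (auto simp: flip_def)

lemma norm_flip [simp]: "norm (flip \<sigma> x) = norm x"
  by (simp add: norm_eq_sqrt_inner flip_inner)

lemma orthonormal_flip: "orthonormal a b \<Longrightarrow> orthonormal (flip \<sigma> a) (flip \<sigma> b)"
  by (simp add: orthonormal_def flip_inner)

lemma flip_great_circle: "flip \<sigma> (great_circle a b t) = great_circle (flip \<sigma> a) (flip \<sigma> b) t"
  by (simp add: flip_def great_circle_def vec_eq_iff algebra_simps)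

lemma flip_minus: "flip \<sigma> (- x) = - flip \<sigma> x"
  by (simp add: flip_def vec_eq_iff)

lemma fold_eq_flip: "(\<And>i. 0 \<le> flip \<sigma> x $ i) \<Longrightarrow> fold_octant x = flip \<sigma> x"
  by (auto simp: flip_def fold_octant_def vec_eq_iff abs_if split: if_splits)
     (metis neg_0_le_iff_le not_less order_antisym_conv order_less_imp_le minus_zero)+

lemma norm_fold [simp]: "norm (fold_octant x) = norm x"
  unfolding norm_vec_def fold_octant_def by simp

lemma fold_minus: "fold_octant (- x) = fold_octant x"
  by (simp add: fold_octant_def vec_eq_iff)

lemma fold_octant_octant: "norm x = 1 \<Longrightarrow> fold_octant x \<in> octant"
  by (simp add: octant_def) (simp add: fold_octant_def)

lemma fold_octant_id: "x \<in> octant \<Longrightarrow> fold_octant x = x"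
  by (simp add: octant_def fold_octant_def vec_eq_iff)

lemma continuous_on_fold: "continuous_on S g \<Longrightarrow> continuous_on S (\<lambda>x. fold_octant (g x))"
  unfolding fold_octant_def by (intro continuous_intros)

lemma continuous_on_flip: "continuous_on S g \<Longrightarrow> continuous_on S (\<lambda>x. flip \<sigma> (g x))"
  unfolding flip_def
proof (rule continuous_on_vec_lambda)
  fix i assume "continuous_on S g"
  then show "continuous_on S (\<lambda>x. if \<sigma> i then g x $ i else - g x $ i)"
    by (cases "\<sigma> i") (auto intro!: continuous_intros)
qed

text \<open>The great circle with normal \<open>cross3 a b\<close> passes through \<open>axis i 1\<close> iff the \<open>i\<close>-th coordinate of
  the normal vanishes. So these are the great circles that avoid the corners of all octants.\<close>

definition generic_circle :: "real^3 \<Rightarrow> real^3 \<Rightarrow> bool" where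
  "generic_circle a b \<longleftrightarrow> orthonormal a b \<and> (\<forall>i. cross3 a b $ i \<noteq> 0)"

lemma cross_great_circle:
  assumes "orthonormal a b"
  shows "cross3 (great_circle a b t) (great_circle b (- a) t) = cross3 a b"
proof -
  have "cross3 (great_circle a b t) (great_circle b (- a) t) =
      (cos t * cos t) *\<^sub>R cross3 a b + (sin t * sin t) *\<^sub>R cross3 a b"
    unfolding great_circle_def using cross_skew[of b a]
    by (simp add: Cross3.right_diff_distrib cross_add_left cross_add_right cross_mult_left
        cross_mult_right algebra_simps)
  also have "\<dots> = cross3 a b"
    by (simp flip: scaleR_add_left power2_eq_square)
  finally show ?thesis .
qed

text \<open>The normal does not depend on the point of the circle at which it is computed. This makes every
  point of the circle available as the starting point.\<close>

lemma generic_great_circle: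
  "generic_circle a b \<Longrightarrow> generic_circle (great_circle a b t) (great_circle b (- a) t)"
  by (simp add: generic_circle_def orthonormal_great_circle cross_great_circle)

text \<open>If both coordinates vanished, the circle would lie in the plane \<open>x $ i = 0\<close>, which contains corners.\<close>

lemma generic_coordinate_pair:
  assumes "generic_circle x y"
  shows "x $ i \<noteq> 0 \<or> y $ i \<noteq> 0"
proof (rule ccontr)
  assume *: "\<not> ?thesis"
  have nz: "cross3 x y $ 1 \<noteq> 0" "cross3 x y $ 2 \<noteq> 0"
    using assms by (auto simp: generic_circle_def)
  show False using nz * exhaust_3[of i] by (auto simp: cross_components)
qed

text \<open>A point of the sphere with two vanishing coordinates is a corner.\<close>

lemma generic_one_zero:
  assumes "generic_circle x y" "x $ i = 0" "j \<noteq> i"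
  shows "x $ j \<noteq> 0"
proof
  assume xj: "x $ j = 0"
  have nz: "cross3 x y $ 1 \<noteq> 0" "cross3 x y $ 2 \<noteq> 0" "cross3 x y $ 3 \<noteq> 0"
    using assms by (auto simp: generic_circle_def)
  show False
    using nz assms(2,3) xj exhaust_3[of i] exhaust_3[of j] by (auto simp: cross_components)
qed

lemma eventually_same_signs:
  "\<exists>\<epsilon>>0. \<epsilon> < pi \<and> (\<forall>s\<in>{t - \<epsilon>..t + \<epsilon>}. \<forall>j. great_circle a b t $ j \<noteq> 0 \<longrightarrow>
     0 < great_circle a b t $ j * great_circle a b s $ j)"
proof -
  let ?x = "great_circle a b"
  have "\<forall>\<^sub>F s in nhds t. ?x t $ j \<noteq> 0 \<longrightarrow> 0 < ?x t $ j * ?x s $ j" for j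
  proof (cases "?x t $ j = 0")
    case False
    have "isCont (\<lambda>s. ?x t $ j * ?x s $ j) t"
      unfolding great_circle_def by (intro continuous_intros)
    then have "((\<lambda>s. ?x t $ j * ?x s $ j) \<longlongrightarrow> ?x t $ j * ?x t $ j) (nhds t)"
      using tendsto_at_iff_tendsto_nhds[of "\<lambda>s. ?x t $ j * ?x s $ j" t] by (simp add: isCont_def)
    moreover have "0 < ?x t $ j * ?x t $ j" using False by (metis not_real_square_gt_zero)
    ultimately show ?thesis by (auto dest: order_tendstoD)
  qed simp
  then have "\<forall>\<^sub>F s in nhds t. \<forall>j. ?x t $ j \<noteq> 0 \<longrightarrow> 0 < ?x t $ j * ?x s $ j"
    by (intro eventually_all_finite)
  then obtain d where "0 < d"
    and d: "\<And>s j. dist s t < d \<Longrightarrow> ?x t $ j \<noteq> 0 \<Longrightarrow> 0 < ?x t $ j * ?x s $ j"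
    unfolding eventually_nhds_metric by blast
  define \<epsilon> where "\<epsilon> = min (d / 2) 1"
  have "0 < \<epsilon>" "\<epsilon> < d" "\<epsilon> < pi" using \<open>0 < d\<close> pi_gt3 by (auto simp: \<epsilon>_def)
  then show ?thesis using d by (intro exI[of _ \<epsilon>]) (auto simp: dist_real_def)
qed

text \<open>Near a point off the coordinate planes folding is a fixed sign change, which is an isometry.\<close>

lemma geodesic_at_fold:
  assumes gen: "generic_circle a b" and nz: "\<And>j. great_circle a b t $ j \<noteq> 0"
  shows "geodesic_at (\<lambda>s. fold_octant (great_circle a b s)) t"
proof -
  let ?x = "great_circle a b"
  have ab: "orthonormal a b" using gen by (simp add: generic_circle_def)
  obtain \<epsilon> where "0 < \<epsilon>" and \<epsilon>: "\<And>s j. s \<in> {t - \<epsilon>..t + \<epsilon>} \<Longrightarrow> 0 < ?x t $ j * ?x s $ j"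
    using eventually_same_signs[of t a b] nz by blast
  define \<sigma> where "\<sigma> j \<longleftrightarrow> 0 < ?x t $ j" for j
  have "fold_octant (?x s) = great_circle (flip \<sigma> a) (flip \<sigma> b) s" if "s \<in> {t - \<epsilon>..t + \<epsilon>}" for s
    unfolding flip_great_circle[symmetric]
  proof (rule fold_eq_flip)
    fix j show "0 \<le> flip \<sigma> (?x s) $ j"
      using \<epsilon>[OF that, of j] by (auto simp: flip_def \<sigma>_def zero_less_mult_iff)
  qed
  then have "sphere_geodesic_on {t - \<epsilon>..t + \<epsilon>} (\<lambda>s. fold_octant (?x s))"
    by (intro sphere_geodesic_on_great_circle[OF orthonormal_flip[OF ab]])
  moreover have "fold_octant (?x t) \<in> octant_interior"
    using nz norm_great_circle[OF ab, of t] by (simp add: octant_interior_def) (simp add: fold_octant_def)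
  ultimately show ?thesis using \<open>0 < \<epsilon>\<close> by (auto simp: geodesic_at_def)
qed

text \<open>The circle crosses the plane \<open>x $ i = 0\<close> transversally, so on the two sides of the crossing time
  folding is the sign change by two sign patterns that differ only in the \<open>i\<close>-th entry. The two
  one-sided velocities are thus mirror images of each other.\<close>

lemma reflects_at_fold:
  assumes gen: "generic_circle a b" and zero: "great_circle a b t $ i = 0"
  shows "reflects_at (\<lambda>s. fold_octant (great_circle a b s)) t"
proof -
  let ?x = "great_circle a b" and ?c = "\<lambda>s. fold_octant (great_circle a b s)"
  have ab: "orthonormal a b" using gen by (simp add: generic_circle_def)
  define y where "y = great_circle b (- a) t"
  have gen_xy: "generic_circle (?x t) y"
    using generic_great_circle[OF gen] by (simp add: y_def)
  have nz: "?x t $ j \<noteq> 0" if "j \<noteq> i" for j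
    using generic_one_zero[OF gen_xy zero that] .
  have yi: "y $ i \<noteq> 0" using generic_coordinate_pair[OF gen_xy, of i] zero by simp
  have xi: "?x s $ i = sin (s - t) * y $ i" for s
    using great_circle_add[of a b t "s - t"] zero by (simp add: y_def great_circle_def[of "great_circle a b t"])
  obtain \<epsilon> where "0 < \<epsilon>" "\<epsilon> < pi"
    and \<epsilon>: "\<And>s j. s \<in> {t - \<epsilon>..t + \<epsilon>} \<Longrightarrow> j \<noteq> i \<Longrightarrow> 0 < ?x t $ j * ?x s $ j"
    using eventually_same_signs[of t a b] nz by metis
  \<comment> \<open>sign patterns of the circle just after (\<open>r\<close>) and just before (\<open>\<not> r\<close>) the crossing\<close>
  define \<sigma> where "\<sigma> r j \<longleftrightarrow> (if j = i then (0 < y $ i) = r else 0 < ?x t $ j)" for r j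
  have eq: "?c s = great_circle (flip (\<sigma> r) a) (flip (\<sigma> r) b) s"
    if rs: "s \<in> (if r then {t..t + \<epsilon>} else {t - \<epsilon>..t})" for s r
    unfolding flip_great_circle[symmetric]
  proof (rule fold_eq_flip)
    fix j
    have s: "s \<in> {t - \<epsilon>..t + \<epsilon>}" using rs \<open>0 < \<epsilon>\<close> by (auto split: if_splits)
    show "0 \<le> flip (\<sigma> r) (?x s) $ j"
    proof (cases "j = i")
      case True
      have "0 \<le> sin (s - t)" if "r"
        using that rs \<open>\<epsilon> < pi\<close> by (intro sin_ge_zero) auto
      moreover have "sin (s - t) \<le> 0" if "\<not> r"
        using sin_ge_zero[of "t - s"] that rs \<open>\<epsilon> < pi\<close>
        by (simp add: sin_diff mult.commute)
      ultimately show ?thesis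
        using True yi by (cases r) (auto simp: flip_def \<sigma>_def xi mult_nonneg_nonneg mult_nonpos_nonpos
            mult_nonneg_nonpos mult_nonpos_nonneg not_less)
    next
      case False
      then show ?thesis
        using \<epsilon>[OF s False] by (auto simp: flip_def \<sigma>_def zero_less_mult_iff)
    qed
  qed
  define v where "v = flip (\<sigma> False) y"
  have vy: "great_circle (flip (\<sigma> r) b) (- flip (\<sigma> r) a) t = flip (\<sigma> r) y" for r
    by (simp add: y_def flip_great_circle flip_minus)
  have refl: "reflect (axis i 1) v = flip (\<sigma> True) y"
    by (auto simp: reflect_def v_def vec_eq_iff inner_axis flip_def \<sigma>_def) (auto simp: axis_def)
  have geo: "sphere_geodesic_on (if r then {t..t + \<epsilon>} else {t - \<epsilon>..t}) ?c" for r
    by (rule sphere_geodesic_on_great_circle[OF orthonormal_flip[OF ab] eq])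
  have deriv: "(?c has_vector_derivative flip (\<sigma> r) y)
      (at t within (if r then {t..t + \<epsilon>} else {t - \<epsilon>..t}))" for r
    unfolding vy[symmetric] using \<open>0 < \<epsilon>\<close>
    by (intro has_vector_derivative_transform[OF _ eq great_circle_has_vector_derivative]) auto
  have "?c t \<in> octant_face i"
    using nz zero norm_great_circle[OF ab, of t] by (simp add: octant_face_def) (simp add: fold_octant_def)
  moreover have "v \<bullet> axis i 1 \<noteq> 0"
    using yi by (simp add: v_def inner_axis flip_def)
  ultimately show ?thesis
    unfolding reflects_at_def
    using geo[of True] geo[of False] deriv[of True] deriv[of False] \<open>0 < \<epsilon>\<close> refl
    by (intro exI[of _ i] exI[of _ \<epsilon>] exI[of _ v]) (simp add: v_def)
qed

proposition fold_great_circle_periodic_broken_ray: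
  assumes "generic_circle a b"
  shows "(\<lambda>t. fold_octant (great_circle a b t)) \<in> periodic_broken_rays"
proof -
  have "orthonormal a b" using assms by (simp add: generic_circle_def)
  moreover have "\<exists>T>0. \<forall>t. fold_octant (great_circle a b (t + T)) = fold_octant (great_circle a b t)"
    by (rule exI[of _ "2 * pi"]) (simp add: great_circle_2pi)
  moreover have "geodesic_at (\<lambda>t. fold_octant (great_circle a b t)) t \<or>
      reflects_at (\<lambda>t. fold_octant (great_circle a b t)) t" for t
    using geodesic_at_fold[OF assms, of t] reflects_at_fold[OF assms, of t] by blast
  ultimately show ?thesis
    by (auto simp: periodic_broken_rays_def fold_octant_octant norm_great_circle)
qed


section \<open>Integrals over the trace of a folded great circle\<close>

text \<open>A linear combination of \<open>cos\<close> and \<open>sin\<close> with a zero at \<open>z\<close> is a multiple of \<open>sin (t - z)\<close>.\<close>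

lemma finite_zeros_on_half_circle:
  fixes \<alpha> \<beta> :: real
  assumes "\<alpha> \<noteq> 0 \<or> \<beta> \<noteq> 0"
  shows "finite {t \<in> {0..pi}. \<alpha> * cos t + \<beta> * sin t = 0}"
proof (cases "\<exists>z\<in>{0..pi}. \<alpha> * cos z + \<beta> * sin z = 0")
  case True
  then obtain z where z: "z \<in> {0..pi}" "\<alpha> * cos z + \<beta> * sin z = 0" by blast
  define k where "k = \<beta> * cos z - \<alpha> * sin z"
  have k: "\<alpha> * cos t + \<beta> * sin t = k * sin (t - z)" for t
  proof -
    have ct: "cos t = cos z * cos (t - z) - sin z * sin (t - z)"
      using cos_add[of z "t - z"] by simp
    have st: "sin t = sin z * cos (t - z) + cos z * sin (t - z)"
      using sin_add[of z "t - z"] by simp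
    have "\<alpha> * cos t + \<beta> * sin t =
        (\<alpha> * cos z + \<beta> * sin z) * cos (t - z) + (\<beta> * cos z - \<alpha> * sin z) * sin (t - z)"
      unfolding ct st by (simp only: algebra_simps)
    then show ?thesis by (simp add: k_def z(2))
  qed
  have "k \<noteq> 0" using k[of 0] k[of "pi / 2"] assms by auto
  \<comment> \<open>\<open>t\<close> and \<open>z\<close> are at most \<open>pi\<close> apart\<close>
  have "{t \<in> {0..pi}. \<alpha> * cos t + \<beta> * sin t = 0} \<subseteq> {z, z - pi, z + pi}"
  proof
    fix t assume "t \<in> {t \<in> {0..pi}. \<alpha> * cos t + \<beta> * sin t = 0}"
    then have t: "t \<in> {0..pi}" "sin (t - z) = 0" using k[of t] \<open>k \<noteq> 0\<close> by auto
    show "t \<in> {z, z - pi, z + pi}"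
    proof (rule ccontr)
      assume "t \<notin> {z, z - pi, z + pi}"
      then have "\<bar>t - z\<bar> < pi" "t - z \<noteq> 0" using t(1) z by auto
      then show False using sin_eq_0_pi[of "t - z"] t(2) by (simp add: abs_less_iff)
    qed
  qed
  then show ?thesis by (rule finite_subset) simp
next
  case False
  then have "{t \<in> {0..pi}. \<alpha> * cos t + \<beta> * sin t = 0} = {}" by blast
  then show ?thesis by (simp only: finite.emptyI)
qed

lemma spherical_segment_great_circle:
  assumes "orthonormal a b"
  shows "spherical_segment pi (great_circle a b)"
proof
  fix s t assume st: "s \<in> {0..pi}" "t \<in> {0..pi}"
  have "great_circle a b s \<bullet> great_circle a b t = cos \<bar>s - t\<bar>"
    using assms by (simp add: great_circle_inner cos_abs_real)
  moreover have "arccos (cos \<bar>s - t\<bar>) = \<bar>s - t\<bar>" using st by (intro arccos_cos) auto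
  ultimately show "sphere_dist (great_circle a b s) (great_circle a b t) = \<bar>s - t\<bar>"
    by (simp only: sphere_dist_def)
qed (use assms in \<open>auto simp: norm_great_circle\<close>)

lemma flip_flip [simp]: "flip \<sigma> (flip \<sigma> x) = x"
  by (simp add: flip_def vec_eq_iff)

text \<open>Two points of the circle with the same folded image differ by a sign change \<open>\<rho>\<close>, so one of them
  lies on two great circles, with normals \<open>n\<close> and \<open>flip \<rho> n\<close>. As no coordinate of \<open>n\<close> is zero, these
  are different circles unless \<open>\<rho>\<close> preserves or reverses all signs. Different great circles meet in
  only two points, and antipodal points of a closed semicircle are its two endpoints.\<close>

lemma finite_overlap:
  assumes gen: "generic_circle a b" and "\<sigma> \<noteq> \<tau>"
  shows "\<exists>Z. finite Z \<and> Z \<subseteq> {0..pi} \<and> (\<forall>s\<in>{0..pi}. \<forall>t\<in>{0..pi}.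
           flip \<sigma> (great_circle a b t) = flip \<tau> (great_circle a b s) \<longrightarrow> t \<in> Z)"
proof -
  let ?x = "great_circle a b" and ?n = "cross3 a b"
  have ab: "orthonormal a b" using gen by (simp add: generic_circle_def)
  \<comment> \<open>the sign change from one point to the other\<close>
  define \<rho> where "\<rho> i \<longleftrightarrow> \<sigma> i = \<tau> i" for i
  have flips: "flip \<sigma> (flip \<tau> z) = flip \<rho> z" for z by (auto simp: flip_def \<rho>_def vec_eq_iff)
  have meet: "?x t = flip \<rho> (?x s)" if "flip \<sigma> (?x t) = flip \<tau> (?x s)" for s t
    using that by (metis flip_flip flips)
  show ?thesis
  proof (cases "\<exists>i. \<rho> i")
    case True
    then obtain i where i: "\<rho> i" ..
    obtain j where j: "\<not> \<rho> j" using \<open>\<sigma> \<noteq> \<tau>\<close> by (auto simp: \<rho>_def)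
    let ?m = "flip \<rho> ?n"
    have "?m \<bullet> a \<noteq> 0 \<or> ?m \<bullet> b \<noteq> 0"
    proof (rule ccontr)
      assume "\<not> ?thesis"
      \<comment> \<open>\<open>?m\<close> would be parallel to \<open>?n\<close>\<close>
      then have "cross3 ?m ?n = 0" by (simp add: Lagrange)
      then have "cross3 ?m ?n $ 1 = 0" "cross3 ?m ?n $ 2 = 0" "cross3 ?m ?n $ 3 = 0" by simp_all
      moreover have "?n $ 1 \<noteq> 0" "?n $ 2 \<noteq> 0" "?n $ 3 \<noteq> 0"
        using gen by (simp_all add: generic_circle_def)
      ultimately have "\<rho> 1 = \<rho> 2" "\<rho> 2 = \<rho> 3"
        unfolding cross_components[of ?m ?n] by (auto simp: flip_def split: if_splits)
      then show False using i j exhaust_3[of i] exhaust_3[of j] by auto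
    qed
    then have "finite {t \<in> {0..pi}. (?m \<bullet> a) * cos t + (?m \<bullet> b) * sin t = 0}"
      by (rule finite_zeros_on_half_circle)
    moreover have "(?m \<bullet> a) * cos t + (?m \<bullet> b) * sin t = 0"
      if "flip \<sigma> (?x t) = flip \<tau> (?x s)" for s t
    proof -
      have "(?m \<bullet> a) * cos t + (?m \<bullet> b) * sin t = ?m \<bullet> ?x t"
        by (simp add: great_circle_def inner_simps mult.commute)
      also have "\<dots> = ?n \<bullet> ?x s" by (simp add: meet[OF that] flip_inner)
      also have "\<dots> = 0" by (simp add: great_circle_def inner_simps dot_cross_self)
      finally show ?thesis .
    qed
    ultimately show ?thesis
      by (intro exI[of _ "{t \<in> {0..pi}. (?m \<bullet> a) * cos t + (?m \<bullet> b) * sin t = 0}"]) blast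
  next
    case False
    have "t \<in> {0, pi}"
      if st: "s \<in> {0..pi}" "t \<in> {0..pi}" and eq: "flip \<sigma> (?x t) = flip \<tau> (?x s)" for s t
    proof -
      have "?x t = - ?x s" using meet[OF eq] False by (simp add: flip_def vec_eq_iff)
      then have "?x t \<bullet> ?x s = - (?x s \<bullet> ?x s)" by simp
      then have c: "cos \<bar>t - s\<bar> = cos pi" using ab by (simp add: great_circle_inner)
      have "\<bar>t - s\<bar> \<le> pi" using st by (auto simp: abs_le_iff)
      then have "\<bar>t - s\<bar> = pi"
        by (rule cos_inj_pi[OF abs_ge_zero _ pi_ge_zero order_refl c])
      then have "t = 0 \<or> t = pi" using st unfolding atLeastAtMost_iff by linarith
      then show ?thesis by simp
    qed
    then show ?thesis by (intro exI[of _ "{0, pi}"]) auto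
  qed
qed

text \<open>Antipodal points have the same folded image.\<close>

lemma fold_great_circle_range:
  "range (\<lambda>t. fold_octant (great_circle a b t)) = (\<lambda>t. fold_octant (great_circle a b t)) ` {0..pi}"
proof (intro equalityI image_subsetI)
  fix t :: real
  define k where "k = \<lfloor>t / pi\<rfloor>"
  define s where "s = t - pi * of_int k"
  have "of_int k \<le> t / pi" "t / pi < of_int k + 1" by (auto simp: k_def)
  then have s: "s \<in> {0..pi}" by (auto simp: s_def field_simps)
  have "great_circle a b t = cos (pi * of_int k) *\<^sub>R great_circle a b s"
    using great_circle_add[of a b s "pi * of_int k"]
    by (simp add: s_def great_circle_def[of "great_circle _ _ _"])
  then have "fold_octant (great_circle a b t) = fold_octant (great_circle a b s)"
    by (auto simp: cos_npi_int fold_minus)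
  then show "fold_octant (great_circle a b t) \<in> (\<lambda>t. fold_octant (great_circle a b t)) ` {0..pi}"
    using s by (auto intro: image_eqI)
qed blast

text \<open>The closed semicircle is covered by the eight closed sets on which the signs of the coordinates are
  given by a pattern \<open>\<sigma>\<close>. These sets, and also their folded images, overlap in null sets only, and
  on each of them folding is an isometry.\<close>

proposition integral_over_folded_trace:
  fixes f :: "real^3 \<Rightarrow> real"
  assumes gen: "generic_circle a b" and f: "continuous_on octant f"
  shows "(LINT x:range (\<lambda>t. fold_octant (great_circle a b t))|hausdorff1. f x) =
         integral {0..pi} (\<lambda>t. f (fold_octant (great_circle a b t)))"
proof -
  let ?x = "great_circle a b" and ?c = "\<lambda>t. fold_octant (great_circle a b t)"
  have ab: "orthonormal a b" using gen by (simp add: generic_circle_def)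
  define D where "D \<sigma> = {t \<in> {0..pi}. \<forall>i. 0 \<le> flip \<sigma> (?x t) $ i}" for \<sigma>
  define A where "A \<sigma> = (\<lambda>t. flip \<sigma> (?x t)) ` D \<sigma>" for \<sigma>
  have seg: "spherical_segment pi (\<lambda>t. flip \<sigma> (?x t))" for \<sigma>
    using spherical_segment_great_circle[OF orthonormal_flip[OF ab]] by (simp add: flip_great_circle)
  have D_sub: "D \<sigma> \<subseteq> {0..pi}" for \<sigma> by (auto simp: D_def)
  have compact_D: "compact (D \<sigma>)" for \<sigma>
  proof -
    have "closed {t. 0 \<le> flip \<sigma> (?x t) $ i}" for i
      by (intro closed_Collect_le continuous_intros continuous_on_flip continuous_on_great_circle)
    then have "closed (\<Inter>i. {t. 0 \<le> flip \<sigma> (?x t) $ i})" by (intro closed_INT) auto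
    then have "compact ({0..pi} \<inter> (\<Inter>i. {t. 0 \<le> flip \<sigma> (?x t) $ i}))"
      by (rule compact_Int_closed[OF compact_Icc])
    also have "{0..pi} \<inter> (\<Inter>i. {t. 0 \<le> flip \<sigma> (?x t) $ i}) = D \<sigma>" by (auto simp: D_def)
    finally show ?thesis .
  qed
  have fold: "flip \<sigma> (?x t) = ?c t" if "t \<in> D \<sigma>" for \<sigma> t
    using that fold_eq_flip[of \<sigma> "?x t"] by (simp add: D_def)
  have A_octant: "A \<sigma> \<subseteq> octant" for \<sigma>
    using fold by (auto simp: A_def fold_octant_octant[OF norm_great_circle[OF ab]])
  have fA: "continuous_on (A \<sigma>) f" for \<sigma> using f A_octant by (rule continuous_on_subset)
  have cover: "(\<Union>\<sigma>. D \<sigma>) = {0..pi}"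
  proof
    show "{0..pi} \<subseteq> (\<Union>\<sigma>. D \<sigma>)"
    proof
      fix t assume "t \<in> {0..pi}"
      then have "t \<in> D (\<lambda>i. 0 \<le> ?x t $ i)" by (simp add: D_def flip_def)
      then show "t \<in> (\<Union>\<sigma>. D \<sigma>)" by blast
    qed
  qed (use D_sub in blast)
  have "range ?c = ?c ` (\<Union>\<sigma>. D \<sigma>)" by (simp only: cover fold_great_circle_range)
  also have "\<dots> = (\<Union>\<sigma>. A \<sigma>)" using fold by (simp add: A_def image_UN cong: image_cong)
  finally have range: "range ?c = (\<Union>\<sigma>. A \<sigma>)" .
  have "(LINT x:range ?c|hausdorff1. f x) = (\<Sum>\<sigma>\<in>UNIV. LINT x:A \<sigma>|hausdorff1. f x)"
    unfolding range
  proof (rule set_integral_finite_UN_AE)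
    fix \<sigma> \<tau> :: "3 \<Rightarrow> bool"
    show "AE x in hausdorff1. x \<in> A \<sigma> \<and> x \<in> A \<tau> \<longrightarrow> \<sigma> = \<tau>"
    proof (cases "\<sigma> = \<tau>")
      case False
      then obtain Z where Z: "finite Z" "Z \<subseteq> {0..pi}"
          "\<And>s t. s \<in> {0..pi} \<Longrightarrow> t \<in> {0..pi} \<Longrightarrow> flip \<sigma> (?x t) = flip \<tau> (?x s) \<Longrightarrow> t \<in> Z"
        using finite_overlap[OF gen False] by blast
      have "AE x in hausdorff1. x \<notin> (\<lambda>t. flip \<sigma> (?x t)) ` Z"
        using spherical_segment.finite_image_null[OF seg Z(1,2)] by (rule AE_not_in)
      then show ?thesis
      proof (rule AE_mp, intro AE_I2 impI)
        fix x assume x: "x \<notin> (\<lambda>t. flip \<sigma> (?x t)) ` Z" "x \<in> A \<sigma> \<and> x \<in> A \<tau>"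
        then obtain s t where st: "t \<in> D \<sigma>" "s \<in> D \<tau>" "x = flip \<sigma> (?x t)" "x = flip \<tau> (?x s)"
          unfolding A_def by blast
        then have "t \<in> Z" using Z(3)[of s t] D_sub by blast
        then show "\<sigma> = \<tau>" using x(1) st(3) by blast
      qed
    qed simp
    show int: "set_integrable hausdorff1 (A \<sigma>) f"
      using spherical_segment.set_integral_arc(1)[OF seg compact_D D_sub] fA by (simp add: A_def)
    have "compact (A \<sigma>)"
      unfolding A_def
      by (intro compact_continuous_image compact_D continuous_on_flip continuous_on_great_circle)
    moreover have "A \<sigma> \<subseteq> unit_sphere" using A_octant[of \<sigma>] by (auto simp: octant_def)
    ultimately show "A \<sigma> \<in> sets hausdorff1"
      by (auto simp: sets_hausdorff1 sets_restrict_space_iff intro: borel_compact)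
  qed simp
  also have "\<dots> = (\<Sum>\<sigma>\<in>UNIV. LINT t:D \<sigma>|lborel. f (?c t))"
  proof (rule sum.cong[OF refl])
    fix \<sigma>
    have "(LINT x:A \<sigma>|hausdorff1. f x) = (LINT t:D \<sigma>|lborel. f (flip \<sigma> (?x t)))"
      using spherical_segment.set_integral_arc(2)[OF seg compact_D D_sub] fA by (simp add: A_def)
    also have "\<dots> = (LINT t:D \<sigma>|lborel. f (?c t))"
      by (rule set_lebesgue_integral_cong) (use compact_D fold in \<open>auto intro: borel_compact\<close>)
    finally show "(LINT x:A \<sigma>|hausdorff1. f x) = (LINT t:D \<sigma>|lborel. f (?c t))" .
  qed
  also have "\<dots> = (LINT t:(\<Union>\<sigma>. D \<sigma>)|lborel. f (?c t))"
  proof (rule set_integral_finite_UN_AE[symmetric])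
    fix \<sigma> \<tau> :: "3 \<Rightarrow> bool"
    show "AE t in lborel. t \<in> D \<sigma> \<and> t \<in> D \<tau> \<longrightarrow> \<sigma> = \<tau>"
    proof (cases "\<sigma> = \<tau>")
      case False
      then obtain i where i: "\<sigma> i \<noteq> \<tau> i" by blast
      have "finite {t \<in> {0..pi}. a $ i * cos t + b $ i * sin t = 0}"
        by (rule finite_zeros_on_half_circle[OF generic_coordinate_pair[OF gen]])
      then have "AE t in lborel. t \<notin> {t \<in> {0..pi}. a $ i * cos t + b $ i * sin t = 0}"
        by (intro AE_not_in finite_imp_null_set_lborel)
      then show ?thesis
      proof (rule AE_mp, intro AE_I2 impI)
        fix t assume t: "t \<notin> {t \<in> {0..pi}. a $ i * cos t + b $ i * sin t = 0}" "t \<in> D \<sigma> \<and> t \<in> D \<tau>"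
        then have "0 \<le> flip \<sigma> (?x t) $ i" "0 \<le> flip \<tau> (?x t) $ i" "t \<in> {0..pi}"
          by (auto simp: D_def)
        then have "?x t $ i = 0" using i by (auto simp: flip_def split: if_splits)
        then show "\<sigma> = \<tau>" using t \<open>t \<in> {0..pi}\<close> by (auto simp: great_circle_def mult.commute)
      qed
    qed simp
    have "continuous_on (D \<sigma>) (\<lambda>t. f (?c t))"
      using fold_octant_octant[OF norm_great_circle[OF ab]]
      by (intro continuous_on_compose2[OF f] continuous_on_fold continuous_on_great_circle) auto
    then show "set_integrable lborel (D \<sigma>) (\<lambda>t. f (?c t))"
      unfolding set_integrable_def by (rule borel_integrable_compact[OF compact_D])
    show "D \<sigma> \<in> sets lborel" using compact_D by (simp add: borel_compact)
  qed simp
  also have "\<dots> = integral {0..pi} (\<lambda>t. f (?c t))"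
    unfolding cover
  proof (rule set_borel_integral_eq_integral(2))
    have "continuous_on {0..pi} (\<lambda>t. f (?c t))"
      using fold_octant_octant[OF norm_great_circle[OF ab]]
      by (intro continuous_on_compose2[OF f] continuous_on_fold continuous_on_great_circle) auto
    then show "set_integrable lborel {0..pi} (\<lambda>t. f (?c t))"
      unfolding set_integrable_def by (rule borel_integrable_compact[OF compact_Icc])
  qed
  finally show ?thesis .
qed


section \<open>Exceptional great circles as limits of generic ones\<close>

lemma continuous_on_great_circle_params:
  fixes h :: "'a::t2_space \<Rightarrow> real"
  assumes "continuous_on S f" "continuous_on S g" "continuous_on S h"
  shows "continuous_on S (\<lambda>z. great_circle (f z) (g z) (h z))"
  unfolding great_circle_def by (intro continuous_intros assms)

lemma continuous_great_circle_integral: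
  fixes F :: "real^3 \<Rightarrow> real"
  assumes F: "continuous_on unit_sphere F"
  shows "continuous_on {z. orthonormal (fst z) (snd z)}
           (\<lambda>z. integral {0..pi} (\<lambda>t. F (great_circle (fst z) (snd z) t)))"
proof -
  have "continuous_on ({z. orthonormal (fst z) (snd z)} \<times> cbox 0 pi)
      (\<lambda>(z, t). F (great_circle (fst z) (snd z) t))"
    unfolding split_beta
    by (intro continuous_on_compose2[OF F] continuous_on_great_circle_params continuous_intros)
       (auto simp: norm_great_circle)
  from integral_continuous_on_param[OF this] show ?thesis by simp
qed

text \<open>The integral depends continuously on the orthonormal pair, and every pair is a limit of generic
  ones: moving the normal by a small positive multiple of \<open>(1, 1, 1)\<close> makes all its coordinates
  nonzero, and a nearby pair with the new normal is obtained from cross products.\<close>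

lemma integral_great_circle_zero_of_generic:
  fixes F :: "real^3 \<Rightarrow> real"
  assumes F: "continuous_on unit_sphere F"
    and zero: "\<And>a b. generic_circle a b \<Longrightarrow> integral {0..pi} (\<lambda>t. F (great_circle a b t)) = 0"
    and ab: "orthonormal a b"
  shows "integral {0..pi} (\<lambda>t. F (great_circle a b t)) = 0"
proof -
  define n where "n = cross3 a b"
  define N where "N e = n + e *\<^sub>R (\<chi> i. 1)" for e :: real
  define A where "A e = sgn (cross3 b (N e))" for e
  define B where "B e = sgn (cross3 (N e) (A e))" for e
  have bn: "cross3 b n = a" and na: "cross3 n a = b"
    using ab cross_skew[of n a] by (simp_all add: n_def Lagrange orthonormal_inner)
  have a0: "a \<noteq> 0" "b \<noteq> 0" using ab by (auto simp: orthonormal_def)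
  have sgn_ab: "sgn a = a" "sgn b = b" using ab by (simp_all add: orthonormal_def sgn_div_norm)
  have cross_tendsto: "((\<lambda>e. cross3 (f e) (g e)) \<longlongrightarrow> cross3 x y) (at_right 0)"
    if "(f \<longlongrightarrow> x) (at_right 0)" "(g \<longlongrightarrow> y) (at_right 0)" for f g :: "real \<Rightarrow> real^3" and x y
    using bilinear_cross that unfolding bilinear_conv_bounded_bilinear by (rule bounded_bilinear.tendsto)
  have "(N \<longlongrightarrow> n + 0 *\<^sub>R (\<chi> i. 1)) (at_right 0)"
    unfolding N_def by (intro tendsto_intros)
  then have N: "(N \<longlongrightarrow> n) (at_right 0)" by simp
  have bN: "((\<lambda>e. cross3 b (N e)) \<longlongrightarrow> a) (at_right 0)"
    using cross_tendsto[OF tendsto_const N, of b] by (simp add: bn)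
  have A: "(A \<longlongrightarrow> a) (at_right 0)"
    unfolding A_def using tendsto_sgn[OF bN a0(1)] by (simp add: sgn_ab)
  have NA: "((\<lambda>e. cross3 (N e) (A e)) \<longlongrightarrow> b) (at_right 0)"
    using cross_tendsto[OF N A] by (simp add: na)
  have B: "(B \<longlongrightarrow> b) (at_right 0)"
    unfolding B_def using tendsto_sgn[OF NA a0(2)] by (simp add: sgn_ab)
  have N_nz: "\<forall>\<^sub>F e in at_right 0. \<forall>i. N e $ i \<noteq> 0"
  proof (rule eventually_all_finite)
    fix i
    show "\<forall>\<^sub>F e in at_right 0. N e $ i \<noteq> 0"
    proof (cases "n $ i = 0")
      case True
      then show ?thesis by (simp add: N_def eventually_at_right_less[THEN eventually_mono])
    next
      case False
      then show ?thesis
        using tendsto_imp_eventually_ne[OF tendsto_vec_nth[OF N]] by blast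
    qed
  qed
  have gen: "\<forall>\<^sub>F e in at_right 0. generic_circle (A e) (B e)"
    using N_nz tendsto_imp_eventually_ne[OF bN a0(1)] tendsto_imp_eventually_ne[OF NA a0(2)]
  proof eventually_elim
    case (elim e)
    have AN: "A e \<bullet> N e = 0"
      by (simp add: A_def sgn_div_norm dot_cross_self)
    have on: "orthonormal (A e) (B e)"
      using elim by (auto simp: orthonormal_def A_def B_def norm_sgn sgn_div_norm dot_cross_self)
    have "cross3 (A e) (cross3 (N e) (A e)) = N e"
      using on AN by (simp add: Lagrange orthonormal_inner)
    then have "cross3 (A e) (B e) = (1 / norm (cross3 (N e) (A e))) *\<^sub>R N e"
      by (simp add: B_def sgn_div_norm cross_mult_right divide_inverse)
    then show ?case using elim on by (simp add: generic_circle_def)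
  qed
  have "((\<lambda>e. integral {0..pi} (\<lambda>t. F (great_circle (fst (A e, B e)) (snd (A e, B e)) t))) \<longlongrightarrow>
      integral {0..pi} (\<lambda>t. F (great_circle (fst (a, b)) (snd (a, b)) t))) (at_right 0)"
    by (rule continuous_on_tendsto_compose[OF continuous_great_circle_integral[OF F] tendsto_Pair[OF A B]])
       (use ab gen in \<open>auto simp: generic_circle_def elim: eventually_mono\<close>)
  moreover have "((\<lambda>e. integral {0..pi} (\<lambda>t. F (great_circle (A e) (B e) t))) \<longlongrightarrow> 0) (at_right 0)"
    by (rule tendsto_eventually) (use gen zero in \<open>auto elim: eventually_mono\<close>)
  ultimately show ?thesis
    using tendsto_unique[OF trivial_limit_at_right_real] by (simp del: trivial_limit_at_right_real)
qed


section \<open>Wallis integrals and the hat-box theorem\<close>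

text \<open>Integrate the derivative of \<open>- cos t * sin t ^ (n + 1)\<close>, which vanishes at both ends.\<close>

lemma sin_power_recurrence:
  "real (n + 2) * integral {0..pi} (\<lambda>t. sin t ^ (n + 2)) = real (n + 1) * integral {0..pi} (\<lambda>t. sin t ^ n)"
proof -
  have int: "(\<lambda>t. sin t ^ k) integrable_on {0..pi}" for k
    by (intro integrable_continuous_real continuous_intros)
  have "((\<lambda>t. real (n + 2) * sin t ^ (n + 2) - real (n + 1) * sin t ^ n) has_integral
      (- cos pi * sin pi ^ (n + 1)) - (- cos 0 * sin 0 ^ (n + 1))) {0..pi}"
  proof (rule fundamental_theorem_of_calculus)
    fix t :: real
    have sq: "cos t * cos t = 1 - sin t * sin t" by (simp add: cos_squared_eq flip: power2_eq_square)
    have "((\<lambda>t. - cos t * sin t ^ (n + 1)) has_real_derivative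
        sin t * sin t ^ (n + 1) - real (n + 1) * sin t ^ n * (cos t * cos t)) (at t within {0..pi})"
    proof -
      have pow: "((\<lambda>t. sin t ^ (n + 1)) has_real_derivative real (n + 1) * (cos t * sin t ^ n)) (at t within {0..pi})"
        using DERIV_power[OF has_field_derivative_at_within[OF DERIV_sin], of "n + 1" t] by simp
      have "((\<lambda>t. - cos t) has_real_derivative sin t) (at t within {0..pi})"
        by (auto intro!: derivative_eq_intros)
      from DERIV_mult[OF this pow] show ?thesis
        by (rule DERIV_cong) (simp add: algebra_simps)
    qed
    then show "((\<lambda>t. - cos t * sin t ^ (n + 1)) has_vector_derivative
        real (n + 2) * sin t ^ (n + 2) - real (n + 1) * sin t ^ n) (at t within {0..pi})"
      unfolding sq by (simp add: has_real_derivative_iff_has_vector_derivative algebra_simps)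
  qed simp
  then have "integral {0..pi} (\<lambda>t. real (n + 2) * sin t ^ (n + 2) - real (n + 1) * sin t ^ n) = 0"
    by (simp add: integral_unique)
  then show ?thesis
    using int[of n] int[of "n + 2"]
    by (subst (asm) integral_diff) (auto intro!: integrable_on_mult_right simp del: power_Suc)
qed

text \<open>By the recurrence the left-hand side does not depend on \<open>n\<close>.\<close>

lemma sin_power_product:
  "real (n + 1) * (integral {0..pi} (\<lambda>t. sin t ^ n) * integral {0..pi} (\<lambda>t. sin t ^ (n + 1))) = 2 * pi"
proof (induction n)
  case 0
  have "(sin has_integral - cos pi - - cos 0) {0..pi}"
    by (rule fundamental_theorem_of_calculus)
       (auto intro!: derivative_eq_intros simp flip: has_real_derivative_iff_has_vector_derivative)
  then have "integral {0..pi} sin = 2" by (simp add: integral_unique)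
  then show ?case by simp
next
  case (Suc n)
  let ?S = "\<lambda>n. integral {0..pi} (\<lambda>t. sin t ^ n)"
  have "real (Suc n + 1) * (?S (Suc n) * ?S (Suc n + 1)) = ?S (n + 1) * (real (n + 2) * ?S (n + 2))"
    by (simp add: algebra_simps)
  also have "\<dots> = real (n + 1) * (?S n * ?S (n + 1))"
    by (simp only: sin_power_recurrence mult_ac)
  also note Suc.IH
  finally show ?case .
qed

lemma continuous_on_sin_sin:
  fixes g :: "real \<Rightarrow> real"
  assumes "continuous_on {0..1} g"
  shows "\<theta> \<in> {0..pi} \<Longrightarrow> continuous_on {0..pi} (\<lambda>\<phi>. g (sin \<theta> * sin \<phi>))"
    and "continuous_on {0..pi} (\<lambda>\<theta>. integral {0..pi} (\<lambda>\<phi>. g (sin \<theta> * sin \<phi>)))"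
proof -
  have mem: "sin \<theta> * sin \<phi> \<in> {0..1}" if "\<theta> \<in> {0..pi}" "\<phi> \<in> {0..pi}" for \<theta> \<phi>
    using that by (auto intro!: mult_nonneg_nonneg mult_le_one sin_ge_zero)
  show "continuous_on {0..pi} (\<lambda>\<phi>. g (sin \<theta> * sin \<phi>))" if "\<theta> \<in> {0..pi}"
    by (intro continuous_on_compose2[OF assms] continuous_intros) (use mem[OF that] in auto)
  have "continuous_on ({0..pi} \<times> cbox 0 pi) (\<lambda>(\<theta>, \<phi>). g (sin \<theta> * sin \<phi>))"
    unfolding split_beta
    by (intro continuous_on_compose2[OF assms] continuous_intros) (use mem in auto)
  from integral_continuous_on_param[OF this]
  show "continuous_on {0..pi} (\<lambda>\<theta>. integral {0..pi} (\<lambda>\<phi>. g (sin \<theta> * sin \<phi>)))"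
    by simp
qed

text \<open>In spherical coordinates \<open>(sin \<theta> cos \<phi>, sin \<theta> sin \<phi>, cos \<theta>)\<close>, with both angles between \<open>0\<close> and
  \<open>pi\<close>, this is the surface integral of \<open>g y\<close> over the hemisphere \<open>y \<ge> 0\<close>.\<close>

definition hemisphere_integral :: "(real \<Rightarrow> real) \<Rightarrow> real" where
  "hemisphere_integral g = integral {0..pi} (\<lambda>\<theta>. sin \<theta> * integral {0..pi} (\<lambda>\<phi>. g (sin \<theta> * sin \<phi>)))"

lemma hemisphere_integral_sum:
  assumes "finite I" "\<And>i. i \<in> I \<Longrightarrow> continuous_on {0..1} (h i)"
  shows "hemisphere_integral (\<lambda>t. \<Sum>i\<in>I. c i * h i t) = (\<Sum>i\<in>I. c i * hemisphere_integral (h i))"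
proof -
  have int: "(\<lambda>\<theta>. sin \<theta> * integral {0..pi} (\<lambda>\<phi>. h i (sin \<theta> * sin \<phi>))) integrable_on {0..pi}" if "i \<in> I" for i
    by (intro integrable_continuous_real continuous_intros continuous_on_sin_sin(2) assms(2) that)
  have "integral {0..pi} (\<lambda>\<phi>. \<Sum>i\<in>I. c i * h i (sin \<theta> * sin \<phi>)) =
      (\<Sum>i\<in>I. c i * integral {0..pi} (\<lambda>\<phi>. h i (sin \<theta> * sin \<phi>)))" if "\<theta> \<in> {0..pi}" for \<theta>
  proof -
    have "(\<lambda>\<phi>. h i (sin \<theta> * sin \<phi>)) integrable_on {0..pi}" if "i \<in> I" for i
      by (intro integrable_continuous_real continuous_on_sin_sin(1) assms(2) that \<open>\<theta> \<in> {0..pi}\<close>)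
    then show ?thesis
      using assms(1) by (subst integral_sum) (auto intro!: integrable_on_mult_right)
  qed
  then have "hemisphere_integral (\<lambda>t. \<Sum>i\<in>I. c i * h i t) =
      integral {0..pi} (\<lambda>\<theta>. \<Sum>i\<in>I. c i * (sin \<theta> * integral {0..pi} (\<lambda>\<phi>. h i (sin \<theta> * sin \<phi>))))"
    unfolding hemisphere_integral_def
    by (intro integral_cong) (simp add: sum_distrib_left mult_ac)
  also have "\<dots> = (\<Sum>i\<in>I. c i * hemisphere_integral (h i))"
    using assms(1) int
    by (subst integral_sum) (auto intro!: integrable_on_mult_right simp: hemisphere_integral_def)
  finally show ?thesis .
qed

text \<open>For powers the double integral is a product of two consecutive Wallis integrals.\<close>

lemma hemisphere_integral_power:
  "hemisphere_integral (\<lambda>t. t ^ n) = 2 * pi * integral {0..1} (\<lambda>t. t ^ n)"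
proof -
  let ?S = "\<lambda>n. integral {0..pi} (\<lambda>t. sin t ^ n)"
  have "hemisphere_integral (\<lambda>t. t ^ n) = integral {0..pi} (\<lambda>\<theta>. ?S n * sin \<theta> ^ (n + 1))"
    unfolding hemisphere_integral_def
    by (intro integral_cong) (simp add: power_mult_distrib mult_ac)
  also have "\<dots> = ?S n * ?S (n + 1)" by simp
  also have "\<dots> = 2 * pi / real (n + 1)"
    using sin_power_product[of n] by (simp add: field_simps del: power_Suc)
  also have "1 / real (n + 1) = integral {0..1} (\<lambda>t::real. t ^ n)"
  proof -
    have "((\<lambda>t::real. t ^ n) has_integral (1 ^ (n + 1) / real (n + 1) - 0 ^ (n + 1) / real (n + 1))) {0..1}"
    proof (rule fundamental_theorem_of_calculus)
      fix t :: real
      have "((\<lambda>t. t ^ (n + 1) / real (n + 1)) has_real_derivative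
          real (n + 1) * t ^ (n + 1 - Suc 0) / real (n + 1)) (at t within {0..1})"
        by (intro DERIV_cdivide DERIV_pow)
      then show "((\<lambda>t. t ^ (n + 1) / real (n + 1)) has_vector_derivative t ^ n) (at t within {0..1})"
        by (simp add: has_real_derivative_iff_has_vector_derivative del: power_Suc of_nat_add of_nat_Suc)
    qed simp
    then show ?thesis by (simp add: integral_unique)
  qed
  then have "2 * pi / real (n + 1) = 2 * pi * integral {0..1} (\<lambda>t::real. t ^ n)"
    by (simp add: divide_inverse)
  finally show ?thesis .
qed

text \<open>The hat-box theorem of Archimedes: the second coordinate is uniformly distributed on the hemisphere.
  Both sides are linear and continuous for the supremum norm and agree on powers, so they agree on all
  continuous functions by the approximation theorem of Weierstrass.\<close>

lemma hemisphere_integral_eq: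
  assumes g: "continuous_on {0..1} g"
  shows "hemisphere_integral g = 2 * pi * integral {0..1} g"
proof -
  let ?L = "\<lambda>g. hemisphere_integral g - 2 * pi * integral {0..1} g"
  have "\<bar>?L g\<bar> \<le> e * (pi * pi + 2 * pi)" if e: "0 < e" for e
  proof -
    obtain p where p: "real_polynomial_function p" and close: "\<And>t. t \<in> {0..1} \<Longrightarrow> \<bar>g t - p t\<bar> < e"
      using Stone_Weierstrass_real_polynomial_function[OF compact_Icc g e] by blast
    obtain c n where pc: "p = (\<lambda>t. \<Sum>i\<le>n. c i * t ^ i)"
      using p real_polynomial_function_iff_sum by blast
    have p_cont: "continuous_on {0..1} p" unfolding pc by (intro continuous_intros)
    have "?L p = 0"
    proof -
      have "integral {0..1} p = (\<Sum>i\<le>n. c i * integral {0..1} (\<lambda>t. t ^ i))"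
        unfolding pc
        by (subst integral_sum) (auto intro!: integrable_continuous_real continuous_intros)
      moreover have "hemisphere_integral p = (\<Sum>i\<le>n. c i * hemisphere_integral (\<lambda>t. t ^ i))"
        unfolding pc by (rule hemisphere_integral_sum) (auto intro!: continuous_intros)
      ultimately show ?thesis
        by (simp add: hemisphere_integral_power sum_distrib_left mult_ac)
    qed
    define h where "h t = g t - p t" for t
    have h: "continuous_on {0..1} h" unfolding h_def by (intro continuous_intros g p_cont)
    have Hh: "hemisphere_integral h = hemisphere_integral g - hemisphere_integral p"
    proof -
      have "continuous_on {0..1} (if b then g else p)" for b using g p_cont by simp
      then show ?thesis
        using hemisphere_integral_sum[of "{True, False}" "\<lambda>b. if b then g else p" "\<lambda>b. if b then 1 else - 1"]
        by (simp add: h_def[abs_def])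
    qed
    have Ih: "integral {0..1} h = integral {0..1} g - integral {0..1} p"
      unfolding h_def by (intro integral_diff integrable_continuous_real g p_cont)
    have "?L h = ?L g - ?L p" unfolding Hh Ih by (simp add: algebra_simps)
    then have Lgh: "?L g = ?L h" using \<open>?L p = 0\<close> by simp
    have he: "\<bar>h t\<bar> \<le> e" if "t \<in> {0..1}" for t using close[OF that] by (simp add: h_def)
    have inner: "\<bar>integral {0..pi} (\<lambda>\<phi>. h (sin \<theta> * sin \<phi>))\<bar> \<le> e * pi" if \<theta>: "\<theta> \<in> {0..pi}" for \<theta>
    proof -
      have "norm (integral {0..pi} (\<lambda>\<phi>. h (sin \<theta> * sin \<phi>))) \<le> e * (pi - 0)"
      proof (rule integral_bound[OF pi_ge_zero continuous_on_sin_sin(1)[OF h \<theta>]])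
        fix \<phi> assume "\<phi> \<in> {0..pi}"
        then have "sin \<theta> * sin \<phi> \<in> {0..1}"
          using \<theta> by (auto intro!: mult_nonneg_nonneg mult_le_one sin_ge_zero)
        then show "norm (h (sin \<theta> * sin \<phi>)) \<le> e" using he by simp
      qed
      then show ?thesis by simp
    qed
    have "norm (hemisphere_integral h) \<le> (e * pi) * (pi - 0)"
      unfolding hemisphere_integral_def
    proof (rule integral_bound[OF pi_ge_zero])
      show "continuous_on {0..pi} (\<lambda>\<theta>. sin \<theta> * integral {0..pi} (\<lambda>\<phi>. h (sin \<theta> * sin \<phi>)))"
        by (intro continuous_intros continuous_on_sin_sin(2) h)
      fix \<theta> assume "\<theta> \<in> {0..pi}"
      then have "\<bar>sin \<theta>\<bar> * \<bar>integral {0..pi} (\<lambda>\<phi>. h (sin \<theta> * sin \<phi>))\<bar> \<le> 1 * (e * pi)"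
        by (intro mult_mono inner) auto
      then show "norm (sin \<theta> * integral {0..pi} (\<lambda>\<phi>. h (sin \<theta> * sin \<phi>))) \<le> e * pi"
        by (simp add: abs_mult)
    qed
    moreover have "norm (integral {0..1} h) \<le> e * (1 - 0)"
      by (rule integral_bound) (use h he in auto)
    ultimately have "\<bar>hemisphere_integral h\<bar> \<le> e * pi * pi" "2 * pi * \<bar>integral {0..1} h\<bar> \<le> 2 * pi * e"
      by auto
    moreover have "\<bar>?L h\<bar> \<le> \<bar>hemisphere_integral h\<bar> + 2 * pi * \<bar>integral {0..1} h\<bar>"
      using abs_triangle_ineq4[of "hemisphere_integral h" "2 * pi * integral {0..1} h"]
      by (simp add: abs_mult)
    ultimately have "\<bar>?L h\<bar> \<le> e * pi * pi + 2 * pi * e" by linarith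
    also have "\<dots> = e * (pi * pi + 2 * pi)" by (simp add: algebra_simps)
    finally show ?thesis unfolding Lgh .
  qed
  note small = this
  have pos: "0 < pi * pi + 2 * pi" by (simp add: add_pos_pos)
  have "\<bar>?L g\<bar> \<le> 0"
  proof (rule field_le_epsilon)
    fix e :: real assume "0 < e"
    then show "\<bar>?L g\<bar> \<le> 0 + e"
      using small[of "e / (pi * pi + 2 * pi)"] pos by simp
  qed
  then show ?thesis by simp
qed

text \<open>Averaging the hypothesis for \<open>s = u * sin \<theta>\<close> over a hemisphere turns it, by the hat-box theorem, into
  the vanishing of the integral of \<open>M\<close> from \<open>0\<close> to \<open>u\<close>; then differentiate in \<open>u\<close>.\<close>

lemma half_circle_means_injective:
  fixes M :: "real \<Rightarrow> real"
  assumes M: "continuous_on {0..1} M"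
    and zero: "\<And>s. s \<in> {0..1} \<Longrightarrow> integral {0..pi} (\<lambda>\<phi>. M (s * sin \<phi>)) = 0"
    and t: "t \<in> {0..1}"
  shows "M t = 0"
proof -
  define P where "P u = integral {0..u} M" for u
  have P': "(P has_vector_derivative M u) (at u within {0..1})" if "u \<in> {0..1}" for u
    unfolding P_def by (rule integral_has_vector_derivative[OF M that])
  have "P u = 0" if u: "u \<in> {0..1}" for u
  proof -
    have mem: "u * t \<in> {0..1}" if "t \<in> {0..1}" for t using that u by (auto intro: mult_le_one)
    have cont: "continuous_on {0..1} (\<lambda>t. M (u * t))"
      by (intro continuous_on_compose2[OF M] continuous_intros) (use mem in auto)
    have "hemisphere_integral (\<lambda>t. M (u * t)) = 0"
    proof -
      have "integral {0..pi} (\<lambda>\<phi>. M (u * (sin \<theta> * sin \<phi>))) = 0" if "\<theta> \<in> {0..pi}" for \<theta>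
        using zero[of "u * sin \<theta>"] mem[of "sin \<theta>"] that by (simp add: mult.assoc sin_ge_zero)
      then have "hemisphere_integral (\<lambda>t. M (u * t)) = integral {0..pi} (\<lambda>\<theta>. 0)"
        unfolding hemisphere_integral_def by (intro integral_cong) simp
      then show ?thesis by simp
    qed
    then have "integral {0..1} (\<lambda>t. M (u * t)) = 0"
      using hemisphere_integral_eq[OF cont] by simp
    moreover have "((\<lambda>t. u * M (u * t)) has_integral (P (u * 1) - P (u * 0))) {0..1}"
    proof (rule fundamental_theorem_of_calculus)
      fix t :: real assume t: "t \<in> {0..1}"
      have "((\<lambda>t. u * t) has_vector_derivative u) (at t within {0..1})"
        by (auto intro!: derivative_eq_intros simp flip: has_real_derivative_iff_has_vector_derivative)
      moreover have "(P has_vector_derivative M (u * t)) (at (u * t) within (\<lambda>t. u * t) ` {0..1})"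
        using mem by (intro has_vector_derivative_within_subset[OF P'[OF mem[OF t]]]) blast
      ultimately have "(P \<circ> (\<lambda>t. u * t) has_vector_derivative u *\<^sub>R M (u * t)) (at t within {0..1})"
        by (rule vector_diff_chain_within)
      then show "((\<lambda>t. P (u * t)) has_vector_derivative u * M (u * t)) (at t within {0..1})"
        by (simp add: o_def)
    qed simp
    then have "u * integral {0..1} (\<lambda>t. M (u * t)) = P u - P 0"
      by (simp add: integral_unique flip: integral_mult_right)
    ultimately show "P u = 0" by (simp add: P_def)
  qed
  then have "(P has_vector_derivative 0) (at t within {0..1})"
    by (intro has_vector_derivative_transform[OF t _ has_vector_derivative_const[of 0]]) auto
  then show ?thesis
    using vector_derivative_unique_within_closed_interval[of 0 1 t P "M t" 0] P'[OF t] t by auto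
qed

lemma integral_full_period_shift:
  fixes h :: "real \<Rightarrow> real"
  assumes h: "continuous_on UNIV h" and per: "\<And>t. h (t + 2 * pi) = h t" and \<delta>: "0 \<le> \<delta>" "\<delta> \<le> 2 * pi"
  shows "integral {0..2 * pi} (\<lambda>t. h (t + \<delta>)) = integral {0..2 * pi} h"
proof -
  have int: "h integrable_on {a..b}" for a b
    using h by (intro integrable_continuous_real) (rule continuous_on_subset, auto)
  have "integral {0..2 * pi} (\<lambda>t. h (t + \<delta>)) = integral {\<delta>..2 * pi + \<delta>} h"
    using integral_shift_Icc_real[of 0 "2 * pi" h \<delta>] by (simp add: o_def add.commute)
  also have "\<dots> = integral {\<delta>..2 * pi} h + integral {2 * pi..2 * pi + \<delta>} h"
    using \<delta> int by (intro Henstock_Kurzweil_Integration.integral_combine[symmetric]) auto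
  also have "integral {2 * pi..2 * pi + \<delta>} h = integral {0..\<delta>} h"
    using integral_shift_Icc_real[of 0 \<delta> h "2 * pi"] per by (simp add: o_def add.commute)
  also have "integral {\<delta>..2 * pi} h + integral {0..\<delta>} h = integral {0..2 * pi} h"
    using Henstock_Kurzweil_Integration.integral_combine[of 0 \<delta> "2 * pi" h] \<delta> int by simp
  finally show ?thesis .
qed


section \<open>Injectivity of the Funk transform\<close>

text \<open>The circle on the left starts at longitude \<open>\<beta>\<close> on the equator of \<open>p\<close> and rises to height \<open>s\<close>. Its
  point at parameter \<open>\<phi>\<close> has height \<open>s * sin \<phi>\<close>, and its longitude exceeds \<open>\<beta>\<close> by an amount \<open>\<delta>\<close>
  that depends on \<open>s\<close> and \<open>\<phi>\<close> only. Averaging over \<open>\<beta>\<close> therefore removes \<open>\<delta>\<close>.\<close>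

lemma great_circle_tilted:
  fixes p e1 e2 :: "real^3"
  assumes "0 \<le> s" "s \<le> 1"
  shows "\<exists>\<delta>. 0 \<le> \<delta> \<and> \<delta> \<le> 2 * pi \<and> (\<forall>\<beta>.
    great_circle (great_circle e1 e2 \<beta>) (s *\<^sub>R p + sqrt (1 - s\<^sup>2) *\<^sub>R great_circle e2 (- e1) \<beta>) \<phi> =
    (s * sin \<phi>) *\<^sub>R p + sqrt (1 - (s * sin \<phi>)\<^sup>2) *\<^sub>R great_circle e1 e2 (\<beta> + \<delta>))"
proof -
  define r where "r = sqrt (1 - s\<^sup>2)"
  define \<rho> where "\<rho> = sqrt (1 - (s * sin \<phi>)\<^sup>2)"
  have "s\<^sup>2 \<le> 1" using assms by (simp add: power_le_one)
  then have r: "r\<^sup>2 = 1 - s\<^sup>2" by (simp add: r_def)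
  have "(s * sin \<phi>)\<^sup>2 \<le> 1"
    using mult_le_one[OF \<open>s\<^sup>2 \<le> 1\<close> zero_le_power2[of "sin \<phi>"]]
    by (simp add: power_mult_distrib abs_square_le_1)
  then have "\<rho>\<^sup>2 = 1 - (s * sin \<phi>)\<^sup>2" by (simp add: \<rho>_def)
  then have \<rho>: "(cos \<phi>)\<^sup>2 + (r * sin \<phi>)\<^sup>2 = \<rho>\<^sup>2"
    by (simp add: power_mult_distrib r cos_squared_eq algebra_simps)
  \<comment> \<open>polar coordinates of the horizontal part; for \<open>\<rho> = 0\<close> the point is a pole and any angle will do\<close>
  obtain \<delta> where \<delta>: "0 \<le> \<delta>" "\<delta> \<le> 2 * pi" "cos \<phi> = \<rho> * cos \<delta>" "r * sin \<phi> = \<rho> * sin \<delta>"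
  proof (cases "\<rho> = 0")
    case True
    then show ?thesis using \<rho> that[of 0] by (simp add: sum_power2_eq_zero_iff)
  next
    case False
    then have "(cos \<phi> / \<rho>)\<^sup>2 + (r * sin \<phi> / \<rho>)\<^sup>2 = 1"
      using \<rho> by (simp add: power_divide flip: add_divide_distrib)
    from sincos_total_2pi_le[OF this] False that show ?thesis by (auto simp: field_simps)
  qed
  have "great_circle (great_circle e1 e2 \<beta>) (s *\<^sub>R p + r *\<^sub>R great_circle e2 (- e1) \<beta>) \<phi> =
      (s * sin \<phi>) *\<^sub>R p + \<rho> *\<^sub>R great_circle e1 e2 (\<beta> + \<delta>)" for \<beta>
  proof -
    have "great_circle (great_circle e1 e2 \<beta>) (s *\<^sub>R p + r *\<^sub>R great_circle e2 (- e1) \<beta>) \<phi> =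
      (s * sin \<phi>) *\<^sub>R p + (cos \<phi> *\<^sub>R great_circle e1 e2 \<beta> + (r * sin \<phi>) *\<^sub>R great_circle e2 (- e1) \<beta>)"
      unfolding great_circle_def[of "great_circle _ _ _"] by (simp add: algebra_simps)
    also have "cos \<phi> *\<^sub>R great_circle e1 e2 \<beta> + (r * sin \<phi>) *\<^sub>R great_circle e2 (- e1) \<beta> =
        \<rho> *\<^sub>R great_circle e1 e2 (\<beta> + \<delta>)"
      unfolding great_circle_add[of e1 e2 \<beta> \<delta>] \<delta>(3,4)
      unfolding great_circle_def[of "great_circle _ _ _"] by (simp add: algebra_simps)
    finally show ?thesis .
  qed
  then show ?thesis using \<delta>(1,2) unfolding r_def \<rho>_def by blast
qed

lemma orthonormal_frame:
  fixes p :: "real^3"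
  assumes "norm p = 1"
  obtains e1 e2 where "orthonormal e1 e2" "p \<bullet> e1 = 0" "p \<bullet> e2 = 0"
proof -
  obtain y where y: "y \<noteq> 0" "orthogonal p y"
    using orthogonal_to_vector_exists[of p] by auto
  define e1 where "e1 = sgn y"
  have e1: "norm e1 = 1" "p \<bullet> e1 = 0"
    using y by (simp_all add: e1_def norm_sgn sgn_div_norm orthogonal_def)
  have "(norm (cross3 p e1))\<^sup>2 = 1"
    using assms e1 by (simp add: norm_cross)
  then have "norm (cross3 p e1) = 1" by (simp add: power2_eq_1_iff) (smt (verit) norm_ge_zero)
  then show ?thesis
    using e1 by (intro that[of e1 "cross3 p e1"]) (auto simp: orthonormal_def dot_cross_self)
qed

text \<open>The idea is to average over rotations about \<open>p\<close>, which reduces the problem to the function \<open>M\<close> of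
  one variable; at height \<open>1\<close> the parallel circle shrinks to the point \<open>p\<close>.\<close>

proposition funk_transform_injective:
  fixes F :: "real^3 \<Rightarrow> real"
  assumes F: "continuous_on unit_sphere F"
    and zero: "\<And>a b. orthonormal a b \<Longrightarrow> integral {0..pi} (\<lambda>t. F (great_circle a b t)) = 0"
    and p: "norm p = 1"
  shows "F p = 0"
proof -
  obtain e1 e2 where e: "orthonormal e1 e2" "p \<bullet> e1 = 0" "p \<bullet> e2 = 0"
    using orthonormal_frame[OF p] .
  have pg: "p \<bullet> great_circle e1 e2 \<beta> = 0" "p \<bullet> great_circle e2 (- e1) \<beta> = 0" for \<beta>
    using e by (simp_all add: great_circle_def inner_simps)
  define q where "q s \<beta> = s *\<^sub>R p + sqrt (1 - s\<^sup>2) *\<^sub>R great_circle e1 e2 \<beta>" for s \<beta>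
  have pp: "p \<bullet> p = 1" using p by (simp add: norm_eq_1)
  have norm_tilt: "norm (s *\<^sub>R p + sqrt (1 - s\<^sup>2) *\<^sub>R v) = 1"
    if "norm v = 1" "p \<bullet> v = 0" "s \<in> {0..1}" for s v
  proof -
    have "s\<^sup>2 \<le> 1" using that(3) by (simp add: power_le_one)
    moreover have "v \<bullet> v = 1" using that(1) by (simp add: norm_eq_1)
    ultimately show ?thesis
      using that(2) pp
      by (simp add: norm_eq_1 inner_simps inner_commute[of v p] flip: power2_eq_square)
  qed
  have q_sphere: "norm (q s \<beta>) = 1" if "s \<in> {0..1}" for s \<beta>
    unfolding q_def by (rule norm_tilt) (use e pg that in \<open>auto simp: norm_great_circle\<close>)
  define M where "M s = integral {0..2 * pi} (\<lambda>\<beta>. F (q s \<beta>))" for s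
  have M_cont: "continuous_on {0..1} M"
  proof -
    have "continuous_on ({0..1} \<times> cbox 0 (2 * pi)) (\<lambda>(s, \<beta>). F (q s \<beta>))"
      unfolding split_beta q_def
      by (intro continuous_on_compose2[OF F] continuous_on_great_circle_params continuous_intros)
         (use q_sphere[unfolded q_def] in auto)
    from integral_continuous_on_param[OF this] show ?thesis by (simp add: M_def[abs_def])
  qed
  have "integral {0..pi} (\<lambda>\<phi>. M (s * sin \<phi>)) = 0" if s: "s \<in> {0..1}" for s
  proof -
    define b where "b \<beta> = s *\<^sub>R p + sqrt (1 - s\<^sup>2) *\<^sub>R great_circle e2 (- e1) \<beta>" for \<beta>
    define G where "G \<beta> \<phi> = F (great_circle (great_circle e1 e2 \<beta>) (b \<beta>) \<phi>)" for \<beta> \<phi>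
    have on: "orthonormal (great_circle e1 e2 \<beta>) (b \<beta>)" for \<beta>
      unfolding orthonormal_def b_def
      using orthonormal_great_circle[OF e(1), of \<beta>] pg norm_tilt[OF _ _ s]
      by (auto simp: orthonormal_def inner_simps inner_commute[of _ p])
    have "integral {0..pi} (\<lambda>\<phi>. integral {0..2 * pi} (\<lambda>\<beta>. G \<beta> \<phi>)) =
        integral {0..2 * pi} (\<lambda>\<beta>. integral {0..pi} (G \<beta>))"
    proof -
      have "continuous_on (cbox (0, 0) (2 * pi, pi)) (\<lambda>(\<beta>, \<phi>). G \<beta> \<phi>)"
        unfolding split_beta G_def b_def
        by (intro continuous_on_compose2[OF F] continuous_on_great_circle_params continuous_intros)
           (use on[unfolded b_def] in \<open>auto simp: norm_great_circle\<close>)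
      from integral_swap_continuous[OF this] show ?thesis by simp
    qed
    also have "\<dots> = 0" by (simp add: G_def[abs_def] zero[OF on])
    finally have averaged: "integral {0..pi} (\<lambda>\<phi>. integral {0..2 * pi} (\<lambda>\<beta>. G \<beta> \<phi>)) = 0" .
    have inner: "integral {0..2 * pi} (\<lambda>\<beta>. G \<beta> \<phi>) = M (s * sin \<phi>)" if \<phi>: "\<phi> \<in> {0..pi}" for \<phi>
    proof -
      have mem: "s * sin \<phi> \<in> {0..1}" using s \<phi> by (auto intro!: mult_nonneg_nonneg mult_le_one sin_ge_zero)
      obtain \<delta> where \<delta>: "0 \<le> \<delta>" "\<delta> \<le> 2 * pi" and eq: "\<And>\<beta>. G \<beta> \<phi> = F (q (s * sin \<phi>) (\<beta> + \<delta>))"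
        using great_circle_tilted[of s e1 e2 p \<phi>] s unfolding G_def b_def q_def by auto
      have "continuous_on UNIV (\<lambda>\<beta>. F (q (s * sin \<phi>) \<beta>))"
        unfolding q_def
        by (intro continuous_on_compose2[OF F] continuous_on_great_circle_params continuous_intros)
           (use q_sphere[OF mem, unfolded q_def] in auto)
      then show ?thesis
        unfolding eq M_def by (rule integral_full_period_shift[OF _ _ \<delta>]) (simp add: q_def great_circle_2pi)
    qed
    have "integral {0..pi} (\<lambda>\<phi>. M (s * sin \<phi>)) = integral {0..pi} (\<lambda>\<phi>. integral {0..2 * pi} (\<lambda>\<beta>. G \<beta> \<phi>))"
      by (rule integral_cong) (simp only: inner)
    with averaged show ?thesis by simp
  qed
  then have "M 1 = 0" using half_circle_means_injective[OF M_cont] by simp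
  then show "F p = 0" by (simp add: M_def q_def)
qed


section \<open>Injectivity of the periodic broken ray transform\<close>

lemma continuous_on_smooth_on_octant:
  assumes "smooth_on_octant f"
  shows "continuous_on octant f"
  unfolding continuous_on_eq_continuous_within
proof
  fix p assume p: "p \<in> octant"
  have "\<exists>U F. open U \<and> p \<in> U \<and> (\<forall>k. Ck_on k F U) \<and> (\<forall>x\<in>U \<inter> octant. F x = f x)"
    using assms p unfolding smooth_on_octant_def by (rule bspec)
  then obtain U F where U: "open U" "p \<in> U" "\<forall>k. Ck_on k F U" "\<forall>x\<in>U \<inter> octant. F x = f x"
    by (elim exE conjE)
  have "continuous_on U F" using spec[OF U(3), of 0] by simp
  then have "isCont F p" using U(1,2) by (simp add: continuous_on_eq_continuous_at)
  then have cF: "continuous (at p within octant) F" by (rule continuous_at_imp_continuous_within)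
  have "\<forall>\<^sub>F x in at p within octant. F x = f x"
    unfolding eventually_at_topological using U(1,2,4) by blast
  then show "continuous (at p within octant) f"
    using cF U(2,4) p by (auto simp: continuous_within intro: Lim_transform_eventually)
qed

theorem proposition30:
  shows "inj_on periodic_broken_ray_transform admissible_functions"
proof (rule inj_onI)
  fix f g
  assume f: "f \<in> admissible_functions" and g: "g \<in> admissible_functions"
    and eq: "periodic_broken_ray_transform f = periodic_broken_ray_transform g"
  have cont: "continuous_on octant f" "continuous_on octant g"
    using f g by (auto simp: admissible_functions_def intro: continuous_on_smooth_on_octant)
  define F where "F x = f (fold_octant x) - g (fold_octant x)" for x
  have cont_fold: "continuous_on unit_sphere (\<lambda>x. h (fold_octant x))"
    if "continuous_on octant h" for h :: "real^3 \<Rightarrow> real"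
    by (intro continuous_on_compose2[OF that] continuous_on_fold continuous_on_id)
       (auto simp: fold_octant_octant)
  have F: "continuous_on unit_sphere F"
    unfolding F_def by (intro continuous_on_diff cont_fold cont)
  have "integral {0..pi} (\<lambda>t. F (great_circle a b t)) = 0" if gen: "generic_circle a b" for a b
  proof -
    let ?c = "\<lambda>t. fold_octant (great_circle a b t)"
    have ab: "orthonormal a b" using gen by (simp add: generic_circle_def)
    have int: "(\<lambda>t. h (?c t)) integrable_on {0..pi}" if "continuous_on octant h" for h :: "real^3 \<Rightarrow> real"
      by (intro integrable_continuous_real continuous_on_compose2[OF cont_fold[OF that]]
          continuous_on_great_circle) (auto simp: norm_great_circle[OF ab])
    have "(LINT x:range ?c|hausdorff1. f x) = (LINT x:range ?c|hausdorff1. g x)"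
      using fun_cong[OF eq, of ?c] fold_great_circle_periodic_broken_ray[OF gen]
      by (simp add: periodic_broken_ray_transform_def)
    then have "integral {0..pi} (\<lambda>t. f (?c t)) = integral {0..pi} (\<lambda>t. g (?c t))"
      by (simp only: integral_over_folded_trace[OF gen] cont)
    then show ?thesis
      unfolding F_def using int[OF cont(1)] int[OF cont(2)] by (simp add: integral_diff)
  qed
  then have zero: "integral {0..pi} (\<lambda>t. F (great_circle a b t)) = 0" if "orthonormal a b" for a b
    using integral_great_circle_zero_of_generic[OF F _ that] by blast
  show "f = g"
  proof (rule extensionalityI[of _ octant])
    fix x assume x: "x \<in> octant"
    then have "F x = 0"
      by (intro funk_transform_injective[OF F zero]) (auto simp: octant_def)
    then show "f x = g x" by (simp add: F_def fold_octant_id[OF x])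
  qed (use f g in \<open>auto simp: admissible_functions_def\<close>)
qed

end
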